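(* Let $G$ be a connected graph of order $n\ge 9$. If $G\not\cong F_n$, then $d(G)\le h(n)$, and equality holds if and only if $G\in\{U_n, T_n\}$ (up to isomorphism), where \[ h(n)=\begin{cases}2^{n-1}+(n+9)\cdot 2^{\frac{n-7}{2}} & n \text{ odd},\\ 2^{n-1}+(n+12)\cdot 2^{\frac{n-8}{2}} & n\text{ even},\end{cases}\qquad F_n=\begin{cases}K_1*\tfrac{n-1}{2}K_2 & n\text{ odd},\\ K_2*\tfrac{n-2}{2}K_2 & n\text{ even},\end{cases}\] \[ U_n=K_3*\Big(\big\lfloor\tfrac{n-3}{2}\big\rfloor K_2\cup \big((n+1)\bmod 2\big)K_1\Big),\qquad T_n=\begin{cases}K_1*\big(2K_1\cup \tfrac{n-3}{2}K_2\big) & n\text{ odd},\\ K_1*\big(3K_1\cup\tfrac{n-4}{2}K_2\big) & n\text{ even}.\end{cases}\]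
   Context: All graphs are finite, simple and undirected. A subset $S$ of vertices of a graph $G$ is a dissociation set if the subgraph induced by $S$ has maximum degree at most one (the empty set is a dissociation set). $d(G)$ denotes the total number of dissociation sets of $G$ (including the empty set). $sK_1\cup tK_2$ denotes the disjoint union of $s$ isolated vertices and $t$ disjoint edges; $0K_1$ means no isolated vertex. The operation $*$: if $H=K_{s_1}\cup\cdots\cup K_{s_t}$ is a disjoint union of complete graphs and $K_r$ is a complete graph disjoint from $H$, then $K_r*H$ is the graph obtained from $K_r\cup H$ by choosing one vertex $u$ of $K_r$ and joining $u$ to exactly one vertex of each component of $H$ (the result is independent of choices up to isomorphism). *)

theory Defs
  imports "Graph_Theory.Graph_Theory"
begin

text \<open>
  Finite simple undirected graphs are the symmetric, loop-free digraphs without parallel arcs of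
  locale \<open>graph\<close>: an edge is a pair of opposite arcs, so the degree of a vertex is its out-degree.
\<close>

definition dissociation_set :: "('a, 'b) pre_digraph \<Rightarrow> 'a set \<Rightarrow> bool" where
  "dissociation_set G S \<longleftrightarrow> S \<subseteq> verts G \<and> (\<forall>v\<in>S. out_degree (G \<restriction> S) v \<le> 1)"

definition num_dissociation_sets :: "('a, 'b) pre_digraph \<Rightarrow> nat" where
  "num_dissociation_sets G = card {S. dissociation_set G S}"

text \<open>
  The disjoint union of complete graphs whose orders are listed in \<open>ss\<close>;
  vertex \<open>(i, j)\<close> is the \<open>j\<close>-th vertex of the \<open>i\<close>-th complete graph.
\<close>

definition clique_union :: "nat list \<Rightarrow> (nat \<times> nat) pair_pre_digraph" where
  "clique_union ss = \<lparr>
     pverts = {(i, j). i < length ss \<and> j < ss ! i},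
     parcs = {((i, j), (i, k)) | i j k. i < length ss \<and> j < ss ! i \<and> k < ss ! i \<and> j \<noteq> k} \<rparr>"

text \<open>
  The graph $K_r * H$, where $H$ is the disjoint union of the complete graphs with orders \<open>ss\<close>.
  All orders are meant to be positive. Component \<open>0\<close> of \<open>clique_union (r # ss)\<close> is $K_r$, the others
  are the components of $H$. The chosen vertex of each component is its \<open>0\<close>-th one, which is no
  restriction since all vertices of a complete graph are alike.
\<close>

definition clique_star :: "nat \<Rightarrow> nat list \<Rightarrow> (nat \<times> nat) pair_pre_digraph" where
  "clique_star r ss = \<lparr>
     pverts = pverts (clique_union (r # ss)),
     parcs = parcs (clique_union (r # ss))
       \<union> {((0, 0), (i, 0)) | i. 1 \<le> i \<and> i \<le> length ss}
       \<union> {((i, 0), (0, 0)) | i. 1 \<le> i \<and> i \<le> length ss} \<rparr>"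

lemma pair_graph_clique_star:
  assumes "0 < r" "0 \<notin> set ss"
  shows "pair_graph (clique_star r ss)"
proof -
  have pos: "0 < ss ! i" if "i < length ss" for i
    using assms(2) nth_mem[OF that] by (metis gr0I)
  have V: "pverts (clique_star r ss) = (SIGMA i:{..<length (r # ss)}. {..<(r # ss) ! i})"
    by (auto simp: clique_star_def clique_union_def)
  have fin: "finite (pverts (clique_star r ss))"
    unfolding V by (intro finite_SigmaI) auto
  have sub: "parcs (clique_star r ss) \<subseteq> pverts (clique_star r ss) \<times> pverts (clique_star r ss)"
    using assms(1) pos
    by (auto simp: clique_star_def clique_union_def nth_Cons' less_Suc_eq_le)
  show ?thesis
  proof unfold_locales
    show "finite (parcs (clique_star r ss))"
      using finite_subset[OF sub] fin by blast
    show "symmetric (with_proj (clique_star r ss))"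
      by (auto simp: symmetric_def sym_def arcs_ends_def arc_to_ends_def clique_star_def clique_union_def)
  qed (use fin sub in \<open>auto simp: clique_star_def clique_union_def\<close>)
qed

lemma card_verts_clique_star: "card (pverts (clique_star r ss)) = r + sum_list ss"
proof -
  have V: "pverts (clique_star r ss) = (SIGMA i:{..<length (r # ss)}. {..<(r # ss) ! i})"
    by (auto simp: clique_star_def clique_union_def)
  have "card (pverts (clique_star r ss)) = (\<Sum>i<length (r # ss). (r # ss) ! i)"
    unfolding V by (subst card_SigmaI) auto
  also have "\<dots> = sum_list (r # ss)"
    by (simp only: sum_list_sum_nth atLeast0LessThan)
  finally show ?thesis by simp
qed

text \<open>For $n \geq 9$ the subtractions do not truncate and the halved exponents are exact.\<close>

definition h_bound :: "nat \<Rightarrow> nat" where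
  "h_bound n = (if odd n then 2 ^ (n - 1) + (n + 9) * 2 ^ ((n - 7) div 2)
                else 2 ^ (n - 1) + (n + 12) * 2 ^ ((n - 8) div 2))"

definition F_graph :: "nat \<Rightarrow> (nat \<times> nat) pair_pre_digraph" where
  "F_graph n = (if odd n then clique_star 1 (replicate ((n - 1) div 2) 2)
                else clique_star 2 (replicate ((n - 2) div 2) 2))"

definition U_graph :: "nat \<Rightarrow> (nat \<times> nat) pair_pre_digraph" where
  "U_graph n = clique_star 3 (replicate ((n - 3) div 2) 2 @ replicate ((n + 1) mod 2) 1)"

definition T_graph :: "nat \<Rightarrow> (nat \<times> nat) pair_pre_digraph" where
  "T_graph n = (if odd n then clique_star 1 (replicate 2 1 @ replicate ((n - 3) div 2) 2)
                else clique_star 1 (replicate 3 1 @ replicate ((n - 4) div 2) 2))"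

end

theory Submission
  imports Defs "HOL-Library.Multiset"
begin

text \<open>
  If some vertex \<open>u\<close> meets all paths on three vertices, every set avoiding \<open>u\<close> is a dissociation
  set and the sets containing \<open>u\<close> can be counted exactly. The count depends only on the order and on
  the number \<open>a\<close> of neighbours of \<open>u\<close> without a private neighbour, and strictly decreases in \<open>a\<close>; the
  values \<open>a \<le> 1\<close> give \<open>F\<close> and \<open>a \<in> {2, 3}\<close> give \<open>U\<close> and \<open>T\<close>.

  Otherwise, consider the proportion \<open>dens\<close> of vertex sets that are dissociation sets. As in a tree
  with a centroid, \<open>V - {u}\<close> splits for a suitable \<open>u\<close> into connected parts, each adjacent to \<open>u\<close> and of
  order at most half of that of \<open>V\<close>. The proportion of dissociation sets avoiding \<open>u\<close> is at most half
  the product of the densities of the parts, and also at most \<open>7 / 16\<close>. Choose a neighbour of \<open>u\<close> in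
  each part: a dissociation set containing \<open>u\<close> contains at most one of them, and with it none of its
  neighbours inside its part. Going through the possible orders of the parts gives a density below
  that of \<open>U\<close> and \<open>T\<close>.
\<close>

section \<open>Densities of dissociation sets\<close>

text \<open>Densities are antitone in the vertex set and submultiplicative over disjoint sets, so a
  bound for connected graphs of one small order passes to all larger orders, and products of such
  bounds control \<open>V - {u}\<close>. Without an apex the target is 1/2, which lies below
  \<open>h_bound n / 2 ^ n\<close> for every order. At small orders this gap has to be used: 73/128,
  139/256 and 69/128 are exactly \<open>h_bound n / 2 ^ n\<close> at \<open>n\<close> = 9, 10, 11.
  The 7/16 comes from a path on three vertices avoiding \<open>u\<close>: at most seven of its eight
  subsets can be traces, and half of all sets avoid \<open>u\<close>. The obstacle is the case of
  two parts. The general estimate allows a proportion 1/4 for the sets containing \<open>u\<close>,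
  which the bounds on the parts cannot make up for at \<open>n\<close> = 9, 10 and from 12 on; a
  separate count lowers it to 15/64. In the apex case the edges inside \<open>A\<close> do not
  influence the count, which is why \<open>U\<close> and \<open>T\<close> tie.\<close>

locale sgraph =
  fixes adj :: "'a \<Rightarrow> 'a \<Rightarrow> bool"
  assumes adj_sym: "adj x y \<Longrightarrow> adj y x"
    and adj_irrefl: "\<not> adj x x"
begin

text \<open>Induced maximum degree at most one, phrased without cardinalities.\<close>

definition dsets :: "'a set \<Rightarrow> 'a set set" where
  "dsets W = {S. S \<subseteq> W \<and> (\<forall>v\<in>S. \<forall>x\<in>S. \<forall>y\<in>S. adj v x \<longrightarrow> adj v y \<longrightarrow> x = y)}"

definition dens :: "'a set \<Rightarrow> real" where
  "dens W = card (dsets W) / 2 ^ card W"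

definition dens_at :: "'a set \<Rightarrow> 'a \<Rightarrow> real" where
  "dens_at W u = card {S \<in> dsets W. u \<in> S} / 2 ^ card W"

lemma dsets_subset_Pow: "dsets W \<subseteq> Pow W"
  by (auto simp: dsets_def)

lemma finite_dsets: "finite W \<Longrightarrow> finite (dsets W)"
  using dsets_subset_Pow finite_subset by fastforce

lemma dsets_Int: "S \<in> dsets W \<Longrightarrow> S \<inter> B \<in> dsets B"
  unfolding dsets_def by fastforce

lemma card_dsets_le: "finite W \<Longrightarrow> card (dsets W) \<le> 2 ^ card W"
  by (metis card_Pow card_mono dsets_subset_Pow finite_Pow_iff)

lemma dens_nonneg: "0 \<le> dens W"
  by (simp add: dens_def)

lemma dens_le_1: "finite W \<Longrightarrow> dens W \<le> 1"
  using card_dsets_le[of W] by (simp add: dens_def)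

text \<open>A set is determined by its traces on \<open>A\<close> and \<open>B\<close>, and both
  traces are dissociation sets; edges between \<open>A\<close> and \<open>B\<close> are
  ignored.\<close>

lemma dens_Un:
  assumes "finite A" "finite B" "A \<inter> B = {}"
  shows "dens (A \<union> B) \<le> dens A * dens B"
proof -
  let ?f = "\<lambda>S. (S \<inter> A, S \<inter> B)"
  have "card (dsets (A \<union> B)) \<le> card (dsets A \<times> dsets B)"
  proof (rule card_inj_on_le)
    show "inj_on ?f (dsets (A \<union> B))"
      by (rule inj_onI) (auto simp: dsets_def)
    show "?f ` dsets (A \<union> B) \<subseteq> dsets A \<times> dsets B"
      using dsets_Int by auto
  qed (use assms finite_dsets in auto)
  then have "real (card (dsets (A \<union> B))) \<le> real (card (dsets A)) * real (card (dsets B))"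
    by (metis card_cartesian_product of_nat_le_iff of_nat_mult)
  then show ?thesis
    using assms by (simp add: dens_def card_Un_disjoint power_add divide_right_mono)
qed

lemma dens_antimono:
  assumes "finite B" "A \<subseteq> B"
  shows "dens B \<le> dens A"
proof -
  have "dens (A \<union> (B - A)) \<le> dens A * dens (B - A)"
    using assms by (intro dens_Un) (auto intro: finite_subset)
  also have "\<dots> \<le> dens A * 1"
    using assms dens_nonneg dens_le_1 by (intro mult_left_mono) auto
  finally show ?thesis
    using assms by (simp add: Un_absorb1)
qed

lemma dens_Union:
  assumes "finite P" "\<And>B. B \<in> P \<Longrightarrow> finite B" "pairwise disjnt P"
  shows "dens (\<Union>P) \<le> (\<Prod>B\<in>P. dens B)"
  using assms
proof (induction P rule: finite_induct)
  case empty
  then show ?case using dens_le_1[of "{}"] by simp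
next
  case (insert B P)
  have "B \<inter> \<Union>P = {}"
    using insert.prems(2) insert.hyps(2) by (fastforce simp: pairwise_insert disjnt_def)
  then have "dens (B \<union> \<Union>P) \<le> dens B * dens (\<Union>P)"
    using insert by (intro dens_Un) auto
  also have "\<dots> \<le> dens B * (\<Prod>B\<in>P. dens B)"
    using insert by (intro mult_left_mono insert.IH dens_nonneg) (auto simp: pairwise_insert)
  finally show ?case using insert.hyps by simp
qed

lemma card_dsets_split:
  assumes "finite V"
  shows "card (dsets V) = card (dsets (V - {u})) + card {S \<in> dsets V. u \<in> S}"
proof -
  have "dsets V = dsets (V - {u}) \<union> {S \<in> dsets V. u \<in> S}"
    unfolding dsets_def by blast
  moreover have "dsets (V - {u}) \<inter> {S \<in> dsets V. u \<in> S} = {}"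
    unfolding dsets_def by blast
  ultimately show ?thesis
    by (metis assms card_Un_disjoint finite_Un finite_dsets)
qed

text \<open>\<open>dens (V - {u})\<close> is relative to one vertex fewer, whence the half, while
  \<open>dens_at\<close> is already relative to \<open>V\<close>.\<close>

lemma dens_split:
  assumes "finite V" "u \<in> V"
  shows "dens V = dens (V - {u}) / 2 + dens_at V u"
proof -
  have "card V = Suc (card (V - {u}))"
    using assms by (metis card_Suc_Diff1)
  then show ?thesis
    using card_dsets_split[OF assms(1), of u]
    by (simp add: dens_def dens_at_def add_divide_distrib)
qed

text \<open>At most one vertex of \<open>R\<close> can accompany \<open>u\<close>. Let
  \<open>W\<close> be the rest of \<open>V\<close>. No vertex of \<open>R\<close> leaves at most
  \<open>2 ^ card W\<close> sets, and so does each vertex of \<open>R - Z\<close>. A vertex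
  \<open>z\<close> of \<open>Z\<close> leaves only half as many: having \<open>u\<close> as a
  neighbour in the set, it excludes its neighbour in \<open>W\<close>.\<close>

lemma dens_at_le:
  assumes "finite V" "u \<in> V" "R \<subseteq> V - {u}" "\<And>x. x \<in> R \<Longrightarrow> adj u x"
    and Z: "Z \<subseteq> R" "\<And>z. z \<in> Z \<Longrightarrow> \<exists>y\<in>V - R - {u}. adj z y"
  shows "dens_at V u \<le> (2 + 2 * real (card R) - real (card Z)) / 2 ^ (card R + 2)"
proof -
  define W where "W = V - R - {u}"
  have "\<forall>z\<in>Z. \<exists>y. y \<in> W \<and> adj z y"
    using Z(2) unfolding W_def by blast
  then obtain y where y: "\<And>z. z \<in> Z \<Longrightarrow> y z \<in> W \<and> adj z (y z)"
    using bchoice[of Z "\<lambda>z y. y \<in> W \<and> adj z y"] by blast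
  have finW: "finite W" and finR: "finite R" and finZ: "finite Z"
    using assms(1,3) Z(1) unfolding W_def by (auto intro: finite_subset)
  have cV: "card V = card W + card R + 1"
  proof -
    have "V = insert u (W \<union> R)" "u \<notin> W \<union> R" "W \<inter> R = {}"
      using assms unfolding W_def by auto
    then show ?thesis using finW finR by (simp add: card_Un_disjoint)
  qed
  let ?X = "insert u ` Pow W"
  let ?Y = "\<Union>z\<in>Z. (\<lambda>T. insert u (insert z T)) ` Pow (W - {y z})"
  let ?Y' = "\<Union>z\<in>R - Z. (\<lambda>T. insert u (insert z T)) ` Pow W"
  have sub: "{S \<in> dsets V. u \<in> S} \<subseteq> ?X \<union> (?Y \<union> ?Y')"
  proof
    fix S assume "S \<in> {S \<in> dsets V. u \<in> S}"
    then have SV: "S \<subseteq> V" and uS: "u \<in> S"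
      and S: "\<And>v x y. v \<in> S \<Longrightarrow> x \<in> S \<Longrightarrow> y \<in> S \<Longrightarrow> adj v x \<Longrightarrow> adj v y \<Longrightarrow> x = y"
      by (auto simp: dsets_def)
    show "S \<in> ?X \<union> (?Y \<union> ?Y')"
    proof (cases "S \<inter> R = {}")
      case True
      then have "S = insert u (S - {u})" "S - {u} \<in> Pow W"
        using SV uS unfolding W_def by auto
      then show ?thesis by blast
    next
      case False
      then obtain z where z: "z \<in> S" "z \<in> R" by blast
      have SR: "S - {u, z} \<subseteq> W"
        using S[OF uS z(1)] z assms(4) SV unfolding W_def by blast
      have eq: "S = insert u (insert z (S - {u, z}))" using uS z by blast
      show ?thesis
      proof (cases "z \<in> Z")
        case True
        have "y z \<notin> S"
          using S[OF z(1) uS, of "y z"] y[OF True] adj_sym assms(4) z(2)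
          unfolding W_def by blast
        then have "S - {u, z} \<in> Pow (W - {y z})" using SR by blast
        then show ?thesis using eq True by blast
      next
        case False
        then show ?thesis using eq SR z(2) by blast
      qed
    qed
  qed
  have c1: "card ?X \<le> 2 ^ card W"
    using card_image_le[of "Pow W" "insert u"] finW by (simp add: card_Pow)
  have c2: "2 * card ?Y \<le> card Z * 2 ^ card W"
  proof -
    have "card ?Y \<le> (\<Sum>z\<in>Z. card ((\<lambda>T. insert u (insert z T)) ` Pow (W - {y z})))"
      using finZ by (rule card_UN_le)
    also have "\<dots> \<le> (\<Sum>z\<in>Z. 2 ^ (card W - 1))"
    proof (rule sum_mono)
      fix z assume "z \<in> Z"
      then have "card (Pow (W - {y z})) = 2 ^ (card W - 1)"
        using y finW by (simp add: card_Pow)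
      then show "card ((\<lambda>T. insert u (insert z T)) ` Pow (W - {y z})) \<le> 2 ^ (card W - 1)"
        using card_image_le[of "Pow (W - {y z})" "\<lambda>T. insert u (insert z T)"] finW by simp
    qed
    finally have *: "card ?Y \<le> card Z * 2 ^ (card W - 1)" by simp
    show ?thesis
    \<comment> \<open>The exponent \<open>card W - 1\<close> would truncate for empty
      \<open>W\<close>, but any element of \<open>Z\<close> has its neighbour there.\<close>
    proof (cases "Z = {}")
      case False
      then have "card W > 0" using y finW card_gt_0_iff by blast
      then have "(2::nat) ^ card W = 2 * 2 ^ (card W - 1)"
        by (metis power_eq_if not_gr_zero)
      then show ?thesis using * by simp
    qed simp
  qed
  have c3: "card ?Y' \<le> card (R - Z) * 2 ^ card W"
  proof -
    have "card ?Y' \<le> (\<Sum>z\<in>R - Z. card ((\<lambda>T. insert u (insert z T)) ` Pow W))"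
      using finR by (intro card_UN_le) auto
    also have "\<dots> \<le> (\<Sum>z\<in>R - Z. 2 ^ card W)"
      by (intro sum_mono order_trans[OF card_image_le]) (simp_all add: finW card_Pow)
    finally show ?thesis by simp
  qed
  have "card {S \<in> dsets V. u \<in> S} \<le> card (?X \<union> (?Y \<union> ?Y'))"
    using finW finR finZ by (intro card_mono sub) auto
  also have "\<dots> \<le> card ?X + (card ?Y + card ?Y')"
    by (meson card_Un_le add_left_mono order_trans)
  finally have "2 * card {S \<in> dsets V. u \<in> S} \<le> (2 + card Z + 2 * card (R - Z)) * 2 ^ card W"
    using c1 c2 c3 by (simp add: algebra_simps)
  moreover have "card R = card Z + card (R - Z)"
    using Z(1) finR finZ by (metis card_Diff_subset card_mono le_add_diff_inverse)
  ultimately have "real (2 * card {S \<in> dsets V. u \<in> S})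
      \<le> real ((2 + card Z + 2 * card (R - Z)) * 2 ^ card W)"
    "real (card R) = real (card Z) + real (card (R - Z))"
    unfolding of_nat_le_iff by simp_all
  then have "2 * real (card {S \<in> dsets V. u \<in> S}) \<le> (2 + 2 * real (card R) - real (card Z)) * 2 ^ card W"
    by (simp add: algebra_simps)
  then show ?thesis
    unfolding dens_at_def cV by (simp add: power_add field_simps)
qed

subsection \<open>Centroids of connected graphs\<close>

text \<open>Connectedness by cuts instead of walks: growing, joining and splitting sets then each
  use a single crossing edge.\<close>

definition conn :: "'a set \<Rightarrow> bool" where
  "conn W \<longleftrightarrow> W \<noteq> {} \<and> (\<forall>X\<subseteq>W. X \<noteq> {} \<longrightarrow> X \<noteq> W \<longrightarrow> (\<exists>x\<in>X. \<exists>y\<in>W - X. adj x y))"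

lemma conn_singleton: "conn {x}"
  unfolding conn_def by blast

lemma conn_cut:
  assumes "conn W" "X \<subseteq> W" "X \<noteq> {}" "X \<noteq> W"
  obtains x y where "x \<in> X" "y \<in> W - X" "adj x y"
  using assms unfolding conn_def by blast

lemma conn_Un:
  assumes A: "conn A" and B: "conn B" and xy: "x \<in> A" "y \<in> B" "adj x y"
  shows "conn (A \<union> B)"
  unfolding conn_def
proof (intro conjI allI impI)
  show "A \<union> B \<noteq> {}" using xy by blast
next
  fix X assume X: "X \<subseteq> A \<union> B" "X \<noteq> {}" "X \<noteq> A \<union> B"
  consider "X \<inter> A \<noteq> {}" "X \<inter> A \<noteq> A" | "X \<inter> B \<noteq> {}" "X \<inter> B \<noteq> B"
    | "A \<subseteq> X" "X \<inter> B = {}" | "B \<subseteq> X" "X \<inter> A = {}"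
    using X by blast
  then show "\<exists>x\<in>X. \<exists>y\<in>A \<union> B - X. adj x y"
  proof cases
    case 1
    then show ?thesis using conn_cut[OF A, of "X \<inter> A"] by blast
  next
    case 2
    then show ?thesis using conn_cut[OF B, of "X \<inter> B"] by blast
  next
    case 3
    then show ?thesis using xy by blast
  next
    case 4
    then show ?thesis using xy adj_sym by blast
  qed
qed

lemma conn_has_neighbour:
  assumes "conn B" "x \<in> B" "B \<noteq> {x}"
  obtains y where "y \<in> B - {x}" "adj x y"
  using conn_cut[OF assms(1), of "{x}"] assms by blast

lemma conn_subset_of_card:
  assumes "conn V" "finite V" "1 \<le> k" "k \<le> card V"
  shows "\<exists>W\<subseteq>V. conn W \<and> card W = k"
  using assms(3,4)
proof (induction k rule: nat_induct_at_least)
  case base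
  obtain x where "x \<in> V" using assms(1) unfolding conn_def by blast
  then show ?case using conn_singleton[of x] by (intro exI[of _ "{x}"]) auto
next
  case (Suc k)
  then obtain W where W: "W \<subseteq> V" "conn W" "card W = k" by auto
  then have "W \<noteq> {}" "W \<noteq> V" using Suc by auto
  then obtain x y where xy: "x \<in> W" "y \<in> V - W" "adj x y"
    using conn_cut[OF assms(1)] W(1) by blast
  have "conn (W \<union> {y})" using conn_Un[OF W(2) conn_singleton] xy by blast
  moreover have "card (W \<union> {y}) = Suc k"
    using W xy finite_subset[OF W(1) assms(2)] by simp
  ultimately show ?case using W xy by (intro exI[of _ "W \<union> {y}"]) auto
qed

text \<open>A nonempty set that is not connected has a cut without crossing edges; both sides are
  smaller, and their components stay closed in the whole set.\<close>

lemma components_exist: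
  assumes "finite W"
  shows "\<exists>P. \<Union>P = W \<and> pairwise disjnt P \<and> (\<forall>B\<in>P. conn B)
    \<and> (\<forall>B\<in>P. \<forall>x\<in>B. \<forall>y\<in>W - B. \<not> adj x y)"
  using assms
proof (induction W rule: finite_psubset_induct)
  case (psubset W)
  consider "W = {}" | "conn W"
    | X where "X \<subseteq> W" "X \<noteq> {}" "X \<noteq> W" "\<forall>x\<in>X. \<forall>y\<in>W - X. \<not> adj x y"
    unfolding conn_def by blast
  then show ?case
  proof cases
    case 1
    then show ?thesis by (intro exI[of _ "{}"]) auto
  next
    case 2
    then show ?thesis by (intro exI[of _ "{W}"]) auto
  next
    case 3
    obtain P where P: "\<Union>P = X" "pairwise disjnt P" "\<forall>B\<in>P. conn B"
      "\<forall>B\<in>P. \<forall>x\<in>B. \<forall>y\<in>X - B. \<not> adj x y"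
      using psubset.IH[of X] 3 by blast
    have "W - X \<subset> W" using 3(1,2) by blast
    then obtain Q where Q: "\<Union>Q = W - X" "pairwise disjnt Q" "\<forall>B\<in>Q. conn B"
      "\<forall>B\<in>Q. \<forall>x\<in>B. \<forall>y\<in>(W - X) - B. \<not> adj x y"
      using psubset.IH[of "W - X"] by meson
    have "pairwise disjnt (P \<union> Q)"
      using P(1,2) Q(1,2) by (simp add: pairwise_def disjnt_def) blast
    moreover have "\<Union>(P \<union> Q) = W" using P(1) Q(1) 3 by auto
    moreover have "\<not> adj x y" if "B \<in> P \<union> Q" "x \<in> B" "y \<in> W - B" for B x y
    proof (cases "B \<in> P")
      case True
      then have "x \<in> X" using P(1) that by blast
      then show ?thesis using True that P(4) 3(4) by (cases "y \<in> X") auto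
    next
      case False
      then have B: "B \<in> Q" using that by blast
      then have "x \<in> W - X" using Q(1) that by blast
      then show ?thesis using B that Q(4) 3(4) adj_sym by (cases "y \<in> X") blast+
    qed
    ultimately show ?thesis
      using P(3) Q(3) by (intro exI[of _ "P \<union> Q"]) auto
  qed
qed

definition star_decomp :: "'a set \<Rightarrow> 'a \<Rightarrow> 'a set set \<Rightarrow> bool" where
  "star_decomp V u P \<longleftrightarrow> u \<in> V \<and> \<Union>P = V - {u} \<and> pairwise disjnt P
    \<and> (\<forall>B\<in>P. conn B \<and> (\<exists>x\<in>B. adj u x))"

text \<open>The parts are the components of \<open>V - {u}\<close>. Some edge of \<open>V\<close>
  leaves each part, and \<open>u\<close> is the only end left for it.\<close>

lemma star_decomp_exists:
  assumes "conn V" "finite V" "u \<in> V"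
  shows "\<exists>P. star_decomp V u P"
proof -
  obtain P where P: "\<Union>P = V - {u}" "pairwise disjnt P" "\<forall>B\<in>P. conn B"
    "\<forall>B\<in>P. \<forall>x\<in>B. \<forall>y\<in>V - {u} - B. \<not> adj x y"
    using components_exist[of "V - {u}"] assms by blast
  have "\<exists>x\<in>B. adj u x" if "B \<in> P" for B
  proof -
    have B: "B \<subseteq> V" "u \<notin> B" "B \<noteq> {}"
      using that P(1,3) unfolding conn_def by blast+
    then obtain x y where "x \<in> B" "y \<in> V - B" "adj x y"
      using conn_cut[OF assms(1), of B] assms(3) by blast
    then show ?thesis using P(4) that adj_sym by blast
  qed
  then show ?thesis using P assms unfolding star_decomp_def by blast
qed

lemma conn_insert_Union:
  assumes "finite P" "\<And>B. B \<in> P \<Longrightarrow> conn B \<and> (\<exists>x\<in>B. adj u x)"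
  shows "conn (insert u (\<Union>P))"
  using assms
proof (induction P rule: finite_induct)
  case empty
  then show ?case using conn_singleton by simp
next
  case (insert B P)
  obtain x where "x \<in> B" "adj u x" using insert by blast
  moreover have "conn (insert u (\<Union>P))" "conn B" using insert by auto
  ultimately have "conn (insert u (\<Union>P) \<union> B)" by (intro conn_Un) auto
  then show ?case by (simp add: Un_commute)
qed

text \<open>The root moves to a neighbour \<open>a\<close> inside \<open>B\<close>. The components
  of \<open>B - {a}\<close> are smaller than \<open>B\<close>, and everything outside
  \<open>B\<close> stays connected through \<open>u\<close> and becomes one part adjacent to
  \<open>a\<close>.\<close>

lemma star_decomp_reroot:
  assumes V: "finite V" and sd: "star_decomp V u P" and B: "B \<in> P"
  shows "\<exists>a Q. star_decomp V a Q \<and> (\<forall>C\<in>Q. C \<subset> B \<or> C = V - B)"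
proof -
  have uV: "u \<in> V" and UP: "\<Union>P = V - {u}" and dP: "pairwise disjnt P"
    and cP: "\<And>C. C \<in> P \<Longrightarrow> conn C \<and> (\<exists>x\<in>C. adj u x)"
    using sd unfolding star_decomp_def by auto
  obtain a where a: "a \<in> B" "adj u a" using cP[OF B] by blast
  have cB: "conn B" using cP[OF B] by blast
  have BV: "B \<subseteq> V - {u}" using UP B by blast
  have finB: "finite B" using BV V finite_subset by blast
  obtain Q where Q: "star_decomp B a Q"
    using star_decomp_exists[OF cB finB a(1)] by blast
  have "P \<subseteq> Pow V" using UP by blast
  then have finP: "finite P" using V finite_subset by blast
  have eq: "insert u (\<Union>(P - {B})) = V - B"
  proof -
    have "B \<inter> C = {}" if "C \<in> P - {B}" for C
      using pairwiseD[OF dP B, of C] that by (auto simp: disjnt_def)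
    then have "\<Union>(P - {B}) = V - {u} - B" using UP by blast
    then show ?thesis using BV uV by auto
  qed
  have "conn (insert u (\<Union>(P - {B})))"
    using finP cP by (intro conn_insert_Union) auto
  then have cVB: "conn (V - B)" using eq by simp
  have "star_decomp V a (insert (V - B) Q)"
    unfolding star_decomp_def
  proof (intro conjI)
    show "a \<in> V" using a BV by blast
    have UQ: "\<Union>Q = B - {a}" using Q unfolding star_decomp_def by blast
    then show "\<Union>(insert (V - B) Q) = V - {a}" using a BV by auto
    show "pairwise disjnt (insert (V - B) Q)"
      using Q UQ unfolding star_decomp_def pairwise_insert disjnt_def by blast
    show "\<forall>C\<in>insert (V - B) Q. conn C \<and> (\<exists>x\<in>C. adj a x)"
      using Q cVB adj_sym[OF a(2)] uV BV unfolding star_decomp_def by blast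
  qed
  moreover have "\<forall>C\<in>insert (V - B) Q. C \<subset> B \<or> C = V - B"
    using Q a unfolding star_decomp_def by blast
  ultimately show ?thesis by blast
qed

text \<open>Rerooting into a part \<open>B\<close> of more than half the order decreases the maximal
  part order: \<open>V - B\<close> is then smaller than \<open>B\<close>, and all other new parts
  lie properly inside \<open>B\<close>. The bound \<open>m\<close> on that maximum drives the
  induction.\<close>

lemma centroid_star_decomp:
  assumes V: "conn V" "finite V"
  shows "\<exists>u P. star_decomp V u P \<and> (\<forall>B\<in>P. 2 * card B \<le> card V)"
proof -
  have "\<exists>u P. star_decomp V u P \<and> (\<forall>B\<in>P. 2 * card B \<le> card V)"
    if "star_decomp V u P" "\<forall>B\<in>P. card B \<le> m" for u P m
    using that
  proof (induction m arbitrary: u P)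
    case 0
    then show ?case by (metis le_zero_eq mult_0_right zero_le)
  next
    case (Suc m)
    show ?case
    proof (cases "\<forall>B\<in>P. 2 * card B \<le> card V")
      case False
      then obtain B where B: "B \<in> P" "2 * card B > card V" by force
      have BV: "B \<subseteq> V" using B(1) Suc.prems unfolding star_decomp_def by blast
      obtain a Q where Q: "star_decomp V a Q" "\<forall>C\<in>Q. C \<subset> B \<or> C = V - B"
        using star_decomp_reroot[OF V(2) Suc.prems(1) B(1)] by blast
      have "card C \<le> m" if "C \<in> Q" for C
      proof -
        have "card (V - B) < card B"
          using B(2) BV V(2) by (simp add: card_Diff_subset finite_subset)
        moreover have "C \<subset> B \<Longrightarrow> card C < card B"
          using BV V(2) by (meson finite_subset psubset_card_mono)
        moreover have "card B \<le> Suc m" using Suc.prems(2) B(1) by blast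
        ultimately show ?thesis using bspec[OF Q(2) that] by (elim disjE) auto
      qed
      then show ?thesis using Suc.IH[OF Q(1)] by blast
    qed (use Suc.prems in blast)
  qed
  moreover obtain u where "u \<in> V" using V unfolding conn_def by blast
  then obtain P where P: "star_decomp V u P" using star_decomp_exists V by blast
  moreover have "\<forall>B\<in>P. card B \<le> card V"
    using P V(2) unfolding star_decomp_def by (metis Diff_subset Sup_le_iff card_mono)
  ultimately show ?thesis by blast
qed

lemma card_insert_image_Pow:
  assumes "finite W" "X \<subseteq> insert a ` Pow W"
  shows "card X \<le> 2 ^ card W"
proof -
  have "card X \<le> card (insert a ` Pow W)"
    using assms by (intro card_mono) auto
  also have "\<dots> \<le> 2 ^ card W"
    using assms(1) card_image_le[of "Pow W" "insert a"] by (simp add: card_Pow)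
  finally show ?thesis .
qed

text \<open>A cut of \<open>B - {a}\<close> becomes a cut of \<open>B\<close> with \<open>a\<close>
  on the side of \<open>b\<close>; the crossing edge cannot end in \<open>a\<close>.\<close>

lemma conn_remove_leaf:
  assumes "conn B" "a \<in> B" "b \<in> B" "a \<noteq> b" and leaf: "\<And>y. y \<in> B \<Longrightarrow> adj a y \<Longrightarrow> y = b"
  shows "conn (B - {a})"
  unfolding conn_def
proof (intro conjI allI impI)
  show "B - {a} \<noteq> {}" using assms by blast
next
  fix X assume X: "X \<subseteq> B - {a}" "X \<noteq> {}" "X \<noteq> B - {a}"
  show "\<exists>x\<in>X. \<exists>y\<in>B - {a} - X. adj x y"
  proof (cases "b \<in> X")
    case False
    have "X \<subseteq> B" "X \<noteq> B" using X assms(2) by auto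
    then obtain x y where xy: "x \<in> X" "y \<in> B - X" "adj x y"
      using conn_cut[OF assms(1), of X] X(2) by blast
    then have "y \<noteq> a" using leaf[of x] adj_sym False X(1) by blast
    then show ?thesis using xy by blast
  next
    case True
    let ?Y = "B - {a} - X"
    have "?Y \<subseteq> B" "?Y \<noteq> B" "?Y \<noteq> {}" using X assms(2) by auto
    then obtain x y where xy: "x \<in> ?Y" "y \<in> B - ?Y" "adj x y"
      using conn_cut[OF assms(1), of ?Y] by blast
    then have "y \<noteq> a" using leaf[of x] adj_sym True X(1) by blast
    then show ?thesis using xy adj_sym by blast
  qed
qed

text \<open>The function \<open>m\<close> collects the bounds known for smaller connected sets. The
  orders are sorted so that the later case analyses are linear arithmetic; \<open>P\<close> is kept
  because the case of two parts needs the sets themselves. For the last bound,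
  \<open>dens_at_le\<close> is used with one neighbour of \<open>u\<close> per part as
  \<open>R\<close> and those in parts of order above 1 as \<open>Z\<close>. With \<open>D\<close>
  parts, \<open>s\<close> of them single vertices, the numerator is 2 + 2D - (D - s) = 2 + D +
  s.\<close>

lemma star_bound:
  assumes V: "conn V" "finite V"
    and m: "\<And>B. B \<subseteq> V \<Longrightarrow> conn B \<Longrightarrow> card B < card V \<Longrightarrow> dens B \<le> m (card B)"
  obtains u P ks where "star_decomp V u P" "mset ks = image_mset card (mset_set P)" "finite P"
    "sorted_wrt (\<ge>) ks"
    "Suc (sum_list ks) = card V" "\<And>k. k \<in> set ks \<Longrightarrow> 1 \<le> k \<and> 2 * k \<le> card V"
    "dens (V - {u}) \<le> prod_list (map m ks)"
    "dens_at V u \<le> (2 + real (length ks) + real (length (filter (\<lambda>k. k = 1) ks))) / 2 ^ (length ks + 2)"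
proof -
  obtain u P where sd: "star_decomp V u P" and half: "\<And>B. B \<in> P \<Longrightarrow> 2 * card B \<le> card V"
    using centroid_star_decomp[OF V] by blast
  have uV: "u \<in> V" and UP: "\<Union>P = V - {u}" and dP: "pairwise disjnt P"
    and cP: "\<And>C. C \<in> P \<Longrightarrow> conn C \<and> (\<exists>x\<in>C. adj u x)"
    using sd unfolding star_decomp_def by auto
  have PV: "C \<subseteq> V - {u}" if "C \<in> P" for C using that UP by blast
  have finC: "finite C" if "C \<in> P" for C using PV[OF that] V(2) finite_subset by blast
  have "P \<subseteq> Pow V" using PV by blast
  then have finP: "finite P" using V finite_subset by blast
  define ks where "ks = rev (sorted_list_of_multiset (image_mset card (mset_set P)))"
  have mks: "mset ks = image_mset card (mset_set P)" unfolding ks_def by simp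
  have sks: "sorted_wrt (\<ge>) ks"
    unfolding ks_def by (simp add: sorted_wrt_rev)
  have len: "length ks = card P"
    using arg_cong[OF mks, of size] by simp
  have sum: "sum_list ks = (\<Sum>C\<in>P. card C)"
    unfolding sum_mset_sum_list[symmetric] mks by (simp add: sum_unfold_sum_mset)
  have cV: "card V = Suc (card (V - {u}))" using V uV by (metis card_Suc_Diff1)
  have cU: "card (V - {u}) = (\<Sum>C\<in>P. card C)"
    unfolding UP[symmetric] using finC dP
    by (subst card_Union_disjoint) (auto simp: pairwise_def disjnt_def)
  have lt: "card C < card V" if "C \<in> P" for C
    using card_mono[OF _ PV[OF that]] V(2) cV by simp
  have "dens (V - {u}) \<le> (\<Prod>C\<in>P. dens C)"
    unfolding UP[symmetric] using finP finC dP by (rule dens_Union)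
  also have "\<dots> \<le> (\<Prod>C\<in>P. m (card C))"
    using m PV cP lt by (intro prod_mono) (auto simp: dens_nonneg)
  also have "\<dots> = prod_list (map m ks)"
    unfolding prod_mset_prod_list[symmetric] mset_map mks
    by (simp add: prod_unfold_prod_mset image_mset.compositionality comp_def)
  finally have 1: "dens (V - {u}) \<le> prod_list (map m ks)" .
  have "\<forall>C\<in>P. \<exists>x. x \<in> C \<and> adj u x" using cP by blast
  then obtain r where r: "\<And>C. C \<in> P \<Longrightarrow> r C \<in> C \<and> adj u (r C)"
    using bchoice[of P "\<lambda>C x. x \<in> C \<and> adj u x"] by blast
  have uniq: "C = C'" if "C \<in> P" "C' \<in> P" "x \<in> C" "x \<in> C'" for C C' x
    using pairwiseD[OF dP that(1,2)] that(3,4) unfolding disjnt_def by blast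
  have inj: "inj_on r P"
    by (rule inj_onI) (metis r uniq)
  let ?Q = "{C \<in> P. card C \<noteq> 1}"
  have 2: "dens_at V u \<le> (2 + 2 * real (card (r ` P)) - real (card (r ` ?Q))) / 2 ^ (card (r ` P) + 2)"
  proof (rule dens_at_le)
    show "r ` P \<subseteq> V - {u}" using r PV by blast
    show "\<exists>y\<in>V - r ` P - {u}. adj z y" if "z \<in> r ` ?Q" for z
    proof -
      obtain C where C: "C \<in> P" "card C \<noteq> 1" "z = r C" using \<open>z \<in> r ` ?Q\<close> by blast
      then obtain y where y: "y \<in> C - {z}" "adj z y"
        using conn_has_neighbour[of C z] cP r by (metis is_singletonI is_singleton_altdef)
      have "y \<notin> r ` P"
        using uniq[OF C(1)] y(1) C(3) r by (metis DiffE imageE insertI1)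
      then show ?thesis using y PV[OF C(1)] by blast
    qed
  qed (use V uV r in auto)
  have "card (r ` P) = length ks" using inj len by (simp add: card_image)
  moreover have "card (r ` ?Q) + length (filter (\<lambda>k. k = 1) ks) = length ks"
  proof -
    have "card (r ` ?Q) = card ?Q" using inj by (intro card_image) (auto intro: inj_on_subset)
    moreover have "length (filter (\<lambda>k. k = 1) ks) = card {C \<in> P. card C = 1}"
    proof -
      have "length (filter (\<lambda>k. k = 1) ks) = size (filter_mset (\<lambda>k. k = 1) (mset ks))"
        by (metis mset_filter size_mset)
      also have "\<dots> = size (filter_mset (\<lambda>C. card C = 1) (mset_set P))"
        unfolding mks by (simp add: filter_mset_image_mset)
      also have "\<dots> = card {C \<in> P. card C = 1}"
        using finP by (simp add: filter_mset_mset_set)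
      finally show ?thesis .
    qed
    moreover have "card ?Q + card {C \<in> P. card C = 1} = card P"
      using finP by (subst card_Un_disjoint[symmetric]) (auto intro: arg_cong[of _ _ card])
    ultimately show ?thesis using len by simp
  qed
  ultimately have "dens_at V u \<le> (2 + real (length ks) + real (length (filter (\<lambda>k. k = 1) ks))) / 2 ^ (length ks + 2)"
    using 2 by (simp add: algebra_simps flip: of_nat_add) (smt (verit) of_nat_add)
  moreover have "1 \<le> k \<and> 2 * k \<le> card V" if "k \<in> set ks" for k
  proof -
    have "k \<in># image_mset card (mset_set P)" using that mks by (metis set_mset_mset)
    then obtain C where "C \<in> P" "k = card C" using finP by auto
    then show ?thesis using half cP[of C] finC[of C] unfolding conn_def
      by (metis One_nat_def Suc_leI card_gt_0_iff)
  qed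
  ultimately show thesis
    using that[OF sd mks finP sks] 1 sum cU cV by simp
qed

lemma list_lengths:
  "length ks = 2 \<Longrightarrow> \<exists>a b. ks = [a, b]"
  "length ks = 3 \<Longrightarrow> \<exists>a b c. ks = [a, b, c]"
  "length ks = 4 \<Longrightarrow> \<exists>a b c d. ks = [a, b, c, d]"
  "length ks = 5 \<Longrightarrow> \<exists>a b c d e. ks = [a, b, c, d, e]"
  by (auto simp: numeral_eq_Suc length_Suc_conv)

lemma length_le_sum_list: "(\<And>k. k \<in> set ks \<Longrightarrow> 1 \<le> k) \<Longrightarrow> length ks \<le> sum_list (ks :: nat list)"
  by (induction ks) fastforce+

section \<open>Connected graphs of order three to six\<close>

lemma dens_conn_extend:
  assumes "\<And>W. finite W \<Longrightarrow> conn W \<Longrightarrow> card W = k \<Longrightarrow> dens W \<le> c" "1 \<le> k"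
    and "conn V" "finite V" "k \<le> card V"
  shows "dens V \<le> c"
proof -
  obtain W where "W \<subseteq> V" "conn W" "card W = k"
    using conn_subset_of_card[OF assms(3,4,2,5)] by blast
  then show ?thesis
    using order_trans[OF dens_antimono[OF assms(4)] assms(1)] finite_subset[OF _ assms(4)] by simp
qed

text \<open>The centroid leaves two single vertices, which gives 1/2 + 6/16.\<close>

lemma dens_conn_3:
  assumes "conn V" "finite V" "3 \<le> card V"
  shows "dens V \<le> 7 / 8"
proof (rule dens_conn_extend[of 3])
  fix W assume W: "finite W" "conn W" "card W = 3"
  have m: "dens B \<le> (\<lambda>_. 1) (card B)" if "B \<subseteq> W" for B
    using dens_le_1 W(1) finite_subset that by blast
  obtain u P ks where *: "star_decomp W u P" "Suc (sum_list ks) = card W"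
    "sorted_wrt (\<ge>) ks" "\<And>k. k \<in> set ks \<Longrightarrow> 1 \<le> k \<and> 2 * k \<le> card W"
    "dens (W - {u}) \<le> prod_list (map (\<lambda>_. 1) ks)"
    "dens_at W u \<le> (2 + real (length ks) + real (length (filter (\<lambda>k. k = 1) ks))) / 2 ^ (length ks + 2)"
    by (rule star_bound[OF W(2,1), of "\<lambda>_. 1"]) (use m in auto)
  have one: "k = 1" if "k \<in> set ks" for k using *(4)[OF that] W(3) by linarith
  then have "sum_list ks = length ks" by (induction ks) auto
  then have "length ks = 2" using *(2) W(3) by simp
  then obtain a b where "ks = [a, b]" using list_lengths(1) by blast
  then have "ks = [1, 1]" using one by auto
  then have "dens (W - {u}) \<le> 1" "dens_at W u \<le> 6 / 16" using *(5,6) by auto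
  moreover have "u \<in> W" using *(1) unfolding star_decomp_def by blast
  ultimately show "dens W \<le> 7 / 8" using dens_split[OF W(1)] by fastforce
qed (use assms in auto)

text \<open>A single part would exceed half the order. With the trivial bound for
  \<open>W - {u}\<close>, the worst orders are 2, 1, giving 1/2 + 5/16.\<close>

lemma dens_conn_4:
  assumes "conn V" "finite V" "4 \<le> card V"
  shows "dens V \<le> 13 / 16"
proof (rule dens_conn_extend[of 4])
  fix W assume W: "finite W" "conn W" "card W = 4"
  have m: "dens B \<le> (\<lambda>_. 1) (card B)" if "B \<subseteq> W" for B
    using dens_le_1 W(1) finite_subset that by blast
  obtain u P ks where *: "star_decomp W u P" "Suc (sum_list ks) = card W"
    "sorted_wrt (\<ge>) ks" "\<And>k. k \<in> set ks \<Longrightarrow> 1 \<le> k \<and> 2 * k \<le> card W"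
    "dens (W - {u}) \<le> prod_list (map (\<lambda>_. 1) ks)"
    "dens_at W u \<le> (2 + real (length ks) + real (length (filter (\<lambda>k. k = 1) ks))) / 2 ^ (length ks + 2)"
    by (rule star_bound[OF W(2,1), of "\<lambda>_. 1"]) (use m in auto)
  have x: "dens (W - {u}) \<le> 1" by (simp add: W(1) dens_le_1)
  have s: "real (length (filter (\<lambda>k. k = 1) ks)) \<le> real (length ks)" by simp
  have uW: "u \<in> W" using *(1) unfolding star_decomp_def by blast
  have "length ks \<le> 3" using length_le_sum_list[of ks] *(2,4) W(3) by force
  moreover have "length ks \<noteq> 0" using *(2) W(3) by auto
  moreover have "length ks \<noteq> 1" using *(2,4) W(3) by (auto simp: length_Suc_conv)
  ultimately consider "length ks = 2" | "length ks = 3" by linarith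
  then have "dens_at W u \<le> 5 / 16"
  proof cases
    case 1
    then obtain a b where ab: "ks = [a, b]" using list_lengths(1) by blast
    then have "a = 2 \<and> b = 1" using *(2,3) *(4)[of a] *(4)[of b] W(3) by auto
    then show ?thesis using *(6) ab by simp
  next
    case 2
    then show ?thesis using *(6) s by simp
  qed
  then show "dens W \<le> 13 / 16" using dens_split[OF W(1) uW] x by linarith
qed (use assms in auto)

text \<open>The worst orders are 2, 2, giving 1/2 + 4/16.\<close>

lemma dens_conn_5:
  assumes "conn V" "finite V" "5 \<le> card V"
  shows "dens V \<le> 3 / 4"
proof (rule dens_conn_extend[of 5])
  fix W assume W: "finite W" "conn W" "card W = 5"
  have m: "dens B \<le> (\<lambda>_. 1) (card B)" if "B \<subseteq> W" for B
    using dens_le_1 W(1) finite_subset that by blast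
  obtain u P ks where *: "star_decomp W u P" "Suc (sum_list ks) = card W"
    "sorted_wrt (\<ge>) ks" "\<And>k. k \<in> set ks \<Longrightarrow> 1 \<le> k \<and> 2 * k \<le> card W"
    "dens (W - {u}) \<le> prod_list (map (\<lambda>_. 1) ks)"
    "dens_at W u \<le> (2 + real (length ks) + real (length (filter (\<lambda>k. k = 1) ks))) / 2 ^ (length ks + 2)"
    by (rule star_bound[OF W(2,1), of "\<lambda>_. 1"]) (use m in auto)
  have x: "dens (W - {u}) \<le> 1" by (simp add: W(1) dens_le_1)
  have s: "real (length (filter (\<lambda>k. k = 1) ks)) \<le> real (length ks)" by simp
  have uW: "u \<in> W" using *(1) unfolding star_decomp_def by blast
  have "length ks \<le> 4" using length_le_sum_list[of ks] *(2,4) W(3) by force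
  moreover have "length ks \<noteq> 0" using *(2) W(3) by auto
  moreover have "length ks \<noteq> 1" using *(2,4) W(3) by (auto simp: length_Suc_conv)
  ultimately consider "length ks = 2" | "length ks = 3" | "length ks = 4" by linarith
  then have "dens_at W u \<le> 1 / 4"
  proof cases
    case 1
    then obtain a b where ab: "ks = [a, b]" using list_lengths(1) by blast
    then have "a = 2 \<and> b = 2" using *(2,3) *(4)[of a] *(4)[of b] W(3) by auto
    then show ?thesis using *(6) ab by simp
  next
    case 2
    then obtain a b c where ab: "ks = [a, b, c]" using list_lengths(2)[of ks] by blast
    then have "a = 2 \<and> b = 1 \<and> c = 1"
      using *(2,3) *(4)[of a] *(4)[of b] *(4)[of c] W(3) by auto
    then show ?thesis using *(6) ab by simp
  next
    case 3
    then show ?thesis using *(6) s by simp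
  qed
  then show "dens W \<le> 3 / 4" using dens_split[OF W(1) uW] x by linarith
qed (use assms in auto)

text \<open>For orders 3, 2 the trivial bound for \<open>W - {u}\<close> would only give 3/4. The
  factor 7/8 of the larger part turns this into 7/16 + 1/4 = 11/16, the same value as 1/2 + 6/32 for
  orders 2, 2, 1.\<close>

lemma dens_conn_6:
  assumes "conn V" "finite V" "6 \<le> card V"
  shows "dens V \<le> 11 / 16"
proof (rule dens_conn_extend[of 6])
  fix W assume W: "finite W" "conn W" "card W = 6"
  let ?m = "\<lambda>k. if k < 3 then 1 else 7 / 8 :: real"
  have m: "dens B \<le> ?m (card B)" if "B \<subseteq> W" "conn B" for B
    using dens_le_1[of B] dens_conn_3[of B] W(1) finite_subset that by auto
  obtain u P ks where *: "star_decomp W u P" "Suc (sum_list ks) = card W"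
    "sorted_wrt (\<ge>) ks" "\<And>k. k \<in> set ks \<Longrightarrow> 1 \<le> k \<and> 2 * k \<le> card W"
    "dens (W - {u}) \<le> prod_list (map ?m ks)"
    "dens_at W u \<le> (2 + real (length ks) + real (length (filter (\<lambda>k. k = 1) ks))) / 2 ^ (length ks + 2)"
    by (rule star_bound[OF W(2,1), of ?m]) (use m in auto)
  have x: "dens (W - {u}) \<le> 1" by (simp add: W(1) dens_le_1)
  have s: "real (length (filter (\<lambda>k. k = 1) ks)) \<le> real (length ks)" by simp
  have uW: "u \<in> W" using *(1) unfolding star_decomp_def by blast
  have "length ks \<le> 5" using length_le_sum_list[of ks] *(2,4) W(3) by force
  moreover have "length ks \<noteq> 0" using *(2) W(3) by auto
  moreover have "length ks \<noteq> 1" using *(2,4) W(3) by (auto simp: length_Suc_conv)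
  ultimately consider "length ks = 2" | "length ks = 3" | "length ks = 4" | "length ks = 5" by linarith
  then have "dens (W - {u}) / 2 + dens_at W u \<le> 11 / 16"
  proof cases
    case 1
    then obtain a b where ab: "ks = [a, b]" using list_lengths(1) by blast
    then have "a = 3 \<and> b = 2" using *(2,3) *(4)[of a] *(4)[of b] W(3) by auto
    then show ?thesis using *(5,6) ab by simp
  next
    case 2
    then obtain a b c where ab: "ks = [a, b, c]" using list_lengths(2)[of ks] by blast
    then have "(a = 3 \<and> b = 1 \<and> c = 1) \<or> (a = 2 \<and> b = 2 \<and> c = 1)"
      using *(2,3) *(4)[of a] *(4)[of b] *(4)[of c] W(3) by auto
    then show ?thesis using *(5,6) ab by auto
  next
    case 3
    then show ?thesis using *(6) s x by simp
  next
    case 4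
    then show ?thesis using *(6) s x by simp
  qed
  then show "dens W \<le> 11 / 16" using dens_split[OF W(1) uW] by linarith
qed (use assms in auto)

section \<open>The sharper count for two parts\<close>

text \<open>
  If \<open>a\<close> is adjacent to a chosen vertex outside \<open>B\<close>, the trace on \<open>B\<close> of a dissociation set
  lies in the family \<open>X\<close> below.
\<close>

lemma card_root_free_sets:
  assumes B: "conn B" "finite B" "4 \<le> card B" and a: "a \<in> B"
  defines "X \<equiv> dsets (B - {a}) \<union> {S \<in> dsets B. a \<in> S \<and> (\<forall>y\<in>S. \<not> adj a y)}"
  shows "16 * card X \<le> 11 * 2 ^ card B"
proof -
  let ?Y = "{S \<in> dsets B. a \<in> S \<and> (\<forall>y\<in>S. \<not> adj a y)}"
  obtain k where k: "card B = k + 4" using B(3) le_Suc_ex by (metis add.commute)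
  have cBa: "card (B - {a}) = k + 3" using a B(2) k by simp
  have "B \<noteq> {a}" using k by auto
  then obtain b where b: "b \<in> B - {a}" "adj a b"
    using conn_has_neighbour[OF B(1) a] by blast
  have "16 * (card (dsets (B - {a})) + card ?Y) \<le> 11 * 2 ^ card B"
  proof (cases "\<exists>c\<in>B. c \<noteq> b \<and> adj a c")
    \<comment> \<open>In sixteenths of \<open>2 ^ card B\<close>: at most 8 for the sets avoiding
      \<open>a\<close>, and 2 for those containing \<open>a\<close>, which miss both
      \<open>b\<close> and \<open>c\<close>.\<close>
    case True
    then obtain c where c: "c \<in> B" "c \<noteq> b" "adj a c" by blast
    have "?Y \<subseteq> insert a ` Pow (B - {a, b, c})"
    proof
      fix S assume "S \<in> ?Y"
      then have "S - {a} \<in> Pow (B - {a, b, c})" "S = insert a (S - {a})"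
        using b c by (auto simp: dsets_def)
      then show "S \<in> insert a ` Pow (B - {a, b, c})" by blast
    qed
    then have "card ?Y \<le> 2 ^ card (B - {a, b, c})"
      using B(2) by (intro card_insert_image_Pow) auto
    moreover have "a \<noteq> c" using c adj_irrefl by blast
    then have "card (B - {a, b, c}) = k + 1"
      using a b c B(2) k by (subst card_Diff_subset) auto
    moreover have "card (dsets (B - {a})) \<le> 2 ^ (k + 3)"
      using card_dsets_le[of "B - {a}"] B(2) cBa by simp
    ultimately show ?thesis using k by (simp add: power_add)
  next
    \<comment> \<open>Here \<open>a\<close> is a leaf of \<open>B\<close>, so \<open>B - {a}\<close>
      is still connected and has order at least 3: 7 sixteenths from the density 7/8, and 4 for the
      sets that contain \<open>a\<close> and miss \<open>b\<close>. This is the extremal case of the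
      bound.\<close>
    case False
    have "conn (B - {a})" using conn_remove_leaf[OF B(1) a] b False by blast
    then have "dens (B - {a}) \<le> 7 / 8" using dens_conn_3 B(2) cBa by simp
    then have "8 * real (card (dsets (B - {a}))) \<le> 7 * 2 ^ (k + 3)"
      unfolding dens_def cBa by (simp add: field_simps)
    then have "real (8 * card (dsets (B - {a}))) \<le> real (7 * 2 ^ (k + 3))" by simp
    then have 1: "8 * card (dsets (B - {a})) \<le> 7 * 2 ^ (k + 3)" unfolding of_nat_le_iff .
    have "?Y \<subseteq> insert a ` Pow (B - {a, b})"
    proof
      fix S assume "S \<in> ?Y"
      then have "S - {a} \<in> Pow (B - {a, b})" "S = insert a (S - {a})"
        using b by (auto simp: dsets_def)
      then show "S \<in> insert a ` Pow (B - {a, b})" by blast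
    qed
    then have "card ?Y \<le> 2 ^ card (B - {a, b})"
      using B(2) by (intro card_insert_image_Pow) auto
    moreover have "card (B - {a, b}) = k + 2"
      using a b B(2) k by (subst card_Diff_subset) auto
    ultimately show ?thesis using k 1 by (simp add: power_add)
  qed
  moreover have "card X \<le> card (dsets (B - {a})) + card ?Y"
    unfolding X_def by (rule card_Un_le)
  ultimately show ?thesis by (meson le_trans mult_le_mono2)
qed

text \<open>If \<open>c\<close> is in the set next to \<open>u\<close>, then \<open>a\<close> and a
  further neighbour \<open>d\<close> of \<open>c\<close> are excluded, a proportion of 1/16. If
  \<open>c\<close> is missing, the trace on \<open>B\<close> lies in the family of
  \<open>card_root_free_sets\<close>, a proportion of at most 11/16 * 1/4 = 11/64.\<close>

lemma dens_at_two_branches: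
  assumes B: "conn B" "finite B" "4 \<le> card B" "a \<in> B" "adj u a"
    and C: "conn C" "finite C" "2 \<le> card C" "c \<in> C" "adj u c"
    and V: "V = insert u (B \<union> C)" "u \<notin> B \<union> C" "B \<inter> C = {}"
  shows "dens_at V u \<le> 15 / 64"
proof -
  define X where "X = dsets (B - {a}) \<union> {S \<in> dsets B. a \<in> S \<and> (\<forall>y\<in>S. \<not> adj a y)}"
  have "C \<noteq> {c}" using C(3) by auto
  then obtain d where d: "d \<in> C - {c}" "adj c d" using conn_has_neighbour[OF C(1,4)] by blast
  let ?D = "{S \<in> dsets V. u \<in> S}"
  let ?E = "X \<times> Pow (C - {c}) \<union> Pow (B - {a}) \<times> insert c ` Pow (C - {c, d})"
  have finX: "finite X" unfolding X_def using B(2) finite_dsets by auto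
  have "card ?D \<le> card ?E"
  proof (rule card_inj_on_le)
    show "inj_on (\<lambda>S. (S \<inter> B, S \<inter> C)) ?D"
      by (rule inj_onI) (use V in \<open>auto simp: dsets_def\<close>)
    show "finite ?E" using finX B(2) C(2) by blast
    show "(\<lambda>S. (S \<inter> B, S \<inter> C)) ` ?D \<subseteq> ?E"
    proof (rule image_subsetI)
      fix S assume SD: "S \<in> ?D"
      then have uS: "u \<in> S"
        and S: "\<And>v x y. v \<in> S \<Longrightarrow> x \<in> S \<Longrightarrow> y \<in> S \<Longrightarrow> adj v x \<Longrightarrow> adj v y \<Longrightarrow> x = y"
        by (auto simp: dsets_def)
      show "(S \<inter> B, S \<inter> C) \<in> ?E"
      proof (cases "c \<in> S")
        case True
        have "a \<notin> S" using S[OF uS True, of a] B(4,5) C(4,5) V(3) by blast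
        moreover have "d \<notin> S"
          using S[OF True uS, of d] d adj_sym[OF C(5)] V(2) by blast
        then have "S \<inter> C - {c} \<in> Pow (C - {c, d})" by blast
        moreover have "S \<inter> C = insert c (S \<inter> C - {c})" using True C(4) by blast
        ultimately show ?thesis by blast
      next
        case False
        have "S \<inter> B \<in> X"
        proof (cases "a \<in> S")
          case True
          have "\<not> adj a y" if "y \<in> S \<inter> B" for y
            using S[OF True uS, of y] adj_sym[OF B(5)] that V(2) by blast
          moreover have "S \<inter> B \<in> dsets B" using SD dsets_Int by blast
          ultimately show ?thesis using True B(4) unfolding X_def by blast
        next
          case False
          then have "S \<inter> B = S \<inter> (B - {a})" by blast
          then show ?thesis using dsets_Int[of S V "B - {a}"] SD unfolding X_def by auto
        qed
        then show ?thesis using False by blast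
      qed
    qed
  qed
  also have "\<dots> \<le> card (X \<times> Pow (C - {c})) + card (Pow (B - {a}) \<times> insert c ` Pow (C - {c, d}))"
    by (rule card_Un_le)
  also have "\<dots> \<le> card X * 2 ^ (card C - 1) + 2 ^ (card B - 1) * 2 ^ (card C - 2)"
  proof -
    have "card (insert c ` Pow (C - {c, d})) \<le> 2 ^ card (C - {c, d})"
      using C(2) by (intro card_insert_image_Pow) auto
    moreover have "card (C - {c, d}) = card C - 2"
      using C(2,4) d by (subst card_Diff_subset) auto
    ultimately show ?thesis
      using B(2,4) C(2,4) by (simp add: card_cartesian_product card_Pow)
  qed
  finally have 1: "card ?D \<le> card X * 2 ^ (card C - 1) + 2 ^ (card B - 1) * 2 ^ (card C - 2)" .
  obtain k where k: "card B = k + 4" using B(3) le_Suc_ex by (metis add.commute)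
  obtain l where l: "card C = l + 2" using C(3) le_Suc_ex by (metis add.commute)
  have "16 * card X \<le> 11 * 2 ^ card B"
    using card_root_free_sets[OF B(1-4)] unfolding X_def .
  then have "16 * card X * 2 ^ (l + 1) \<le> 11 * 2 ^ card B * 2 ^ (l + 1)" by (rule mult_le_mono1)
  moreover have "16 * card ?D \<le> 16 * card X * 2 ^ (l + 1) + 16 * (2 ^ (k + 3) * 2 ^ l)"
    using mult_le_mono2[OF 1, of 16] unfolding k l by (simp add: algebra_simps)
  ultimately have "16 * card ?D \<le> 11 * 2 ^ card B * 2 ^ (l + 1) + 16 * (2 ^ (k + 3) * 2 ^ l)"
    by (meson add_le_mono1 le_trans)
  also have "\<dots> = 15 * 2 ^ (k + l + 5)" unfolding k by (simp add: power_add)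
  finally have "real (16 * card ?D) \<le> real (15 * 2 ^ (k + l + 5))" unfolding of_nat_le_iff .
  moreover have "card V = k + l + 7"
    using V k l B(2) C(2) by (simp add: card_Un_disjoint)
  ultimately show ?thesis unfolding dens_at_def by (simp add: power_add field_simps)
qed

end

section \<open>Numerical bounds by the orders of the parts\<close>

text \<open>The value at \<open>3 \<le> k \<le> 6\<close> is the density of the best connected graph of order \<open>k\<close>.\<close>

definition conn_bound :: "nat \<Rightarrow> real" where
  "conn_bound k = (if k < 3 then 1 else if k = 3 then 7 / 8 else if k = 4 then 13 / 16
     else if k = 5 then 3 / 4 else 11 / 16)"

lemma conn_bound_le:
  "conn_bound k \<le> 1" "3 \<le> k \<Longrightarrow> conn_bound k \<le> 7 / 8" "4 \<le> k \<Longrightarrow> conn_bound k \<le> 13 / 16"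
  "5 \<le> k \<Longrightarrow> conn_bound k \<le> 3 / 4" "6 \<le> k \<Longrightarrow> conn_bound k \<le> 11 / 16"
  by (auto simp: conn_bound_def)

lemma conn_bound_nonneg: "0 \<le> conn_bound k"
  by (simp add: conn_bound_def)

text \<open>All factors are at most 1, so a product may be cut off after its largest parts;
  \<open>c\<close> is the portion that is kept.\<close>

lemma prod_conn_bound_le: "0 \<le> c \<Longrightarrow> c * prod_list (map conn_bound ks) \<le> c"
proof (induction ks arbitrary: c)
  case (Cons k ks)
  have "c * conn_bound k \<le> c" "0 \<le> c * conn_bound k"
    using Cons.prems conn_bound_le(1)[of k] conn_bound_nonneg[of k]
    by (auto simp: mult_left_le)
  then show ?case using Cons.IH[of "c * conn_bound k"] by (simp add: mult.assoc)
qed simp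

lemma prod_conn_bound_le1:
  assumes "conn_bound k \<le> x"
  shows "prod_list (map conn_bound (k # ks)) \<le> x"
  using prod_conn_bound_le[OF conn_bound_nonneg, of k ks] assms by simp

lemma prod_conn_bound_le2:
  assumes "conn_bound k \<le> x" "conn_bound l \<le> y"
  shows "prod_list (map conn_bound (k # l # ks)) \<le> x * y"
proof -
  have "prod_list (map conn_bound (k # l # ks)) \<le> conn_bound k * conn_bound l"
    using prod_conn_bound_le[of "conn_bound k * conn_bound l" ks] conn_bound_nonneg
    by (simp add: mult.assoc)
  also have "\<dots> \<le> x * y"
    using assms conn_bound_nonneg by (intro mult_mono) (auto intro: order_trans)
  finally show ?thesis .
qed

lemma prod_conn_bound_le3:
  assumes "conn_bound k \<le> x" "conn_bound l \<le> y" "conn_bound j \<le> z"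
  shows "prod_list (map conn_bound (k # l # j # ks)) \<le> x * (y * z)"
proof -
  have x: "0 \<le> x" using assms(1) conn_bound_nonneg[of k] by linarith
  have "prod_list (map conn_bound (k # l # j # ks)) = conn_bound k * prod_list (map conn_bound (l # j # ks))"
    by simp
  also have "\<dots> \<le> x * prod_list (map conn_bound (l # j # ks))"
    by (intro mult_right_mono assms prod_list_nonneg) (auto simp: conn_bound_nonneg)
  also have "\<dots> \<le> x * (y * z)"
    by (intro mult_left_mono prod_conn_bound_le2 assms x)
  finally show ?thesis .
qed

text \<open>In this and the following profiles, \<open>x\<close> and \<open>q\<close> stand for
  \<open>dens (V - {u})\<close> and \<open>dens_at V u\<close>. A single vertex as a part raises the
  bound on \<open>q\<close>, so \<open>c = 1\<close> is separate; balance then forces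
  \<open>b\<close> to be at least 3. Otherwise \<open>q\<close> is at most 5/32 and any product up
  to 11/16 yields 1/2, which \<open>6 \<le> a\<close> just meets.\<close>

lemma star_profile_3:
  assumes n: "n \<ge> 9" and s: "a \<ge> b" "b \<ge> c" "Suc (a + b + c) = n" "1 \<le> c" "2 * a \<le> n"
    and x: "x \<le> prod_list (map conn_bound [a, b, c])"
    and q: "q \<le> (5 + real (length (filter (\<lambda>k. k = 1) [a, b, c]))) / 32"
  shows "x / 2 + q \<le> 1 / 2 \<or> n = 9 \<and> x / 2 + q < 73 / 128 \<or> n = 10 \<and> x / 2 + q < 139 / 256"
proof (cases "c = 1")
  case True
  then have b: "3 \<le> b" using n s by linarith
  then have q': "q \<le> 6 / 32" using q True s by auto
  consider "n = 9" "4 \<le> a" | "n = 10" "5 \<le> a" | "n = 10" "4 \<le> a" "4 \<le> b" | "n \<ge> 11" "5 \<le> a" "4 \<le> b"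
    using n s True by linarith
  then show ?thesis
  proof cases
    case 1
    then show ?thesis using x q' prod_conn_bound_le2[OF conn_bound_le(3) conn_bound_le(2), of a b "[c]"] b by auto
  next
    case 2
    then show ?thesis using x q' prod_conn_bound_le2[OF conn_bound_le(4) conn_bound_le(2), of a b "[c]"] b by auto
  next
    case 3
    then show ?thesis using x q' prod_conn_bound_le2[OF conn_bound_le(3) conn_bound_le(3), of a b "[c]"] by auto
  next
    case 4
    then show ?thesis using x q' prod_conn_bound_le2[OF conn_bound_le(4) conn_bound_le(3), of a b "[c]"] by auto
  qed
next
  case False
  then have q': "q \<le> 5 / 32" using q s by auto
  consider "n = 9" "4 \<le> a" | "n = 9" "3 \<le> a" "3 \<le> b" | "n = 10" "5 \<le> a" | "n = 10" "3 \<le> a" "3 \<le> b"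
    | "6 \<le> a" | "5 \<le> a" "3 \<le> b" | "4 \<le> a" "4 \<le> b" | "3 \<le> a" "3 \<le> b" "3 \<le> c"
    using n s False by linarith
  then show ?thesis
  proof cases
    case 1
    then show ?thesis using x q' prod_conn_bound_le1[OF conn_bound_le(3), of a "[b, c]"] by auto
  next
    case 2
    then show ?thesis using x q' prod_conn_bound_le2[OF conn_bound_le(2) conn_bound_le(2), of a b "[c]"] by auto
  next
    case 3
    then show ?thesis using x q' prod_conn_bound_le1[OF conn_bound_le(4), of a "[b, c]"] by auto
  next
    case 4
    then show ?thesis using x q' prod_conn_bound_le2[OF conn_bound_le(2) conn_bound_le(2), of a b "[c]"] by auto
  next
    case 5
    then show ?thesis using x q' prod_conn_bound_le1[OF conn_bound_le(5), of a "[b, c]"] by auto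
  next
    case 6
    then show ?thesis using x q' prod_conn_bound_le2[OF conn_bound_le(4) conn_bound_le(2), of a b "[c]"] by auto
  next
    case 7
    then show ?thesis using x q' prod_conn_bound_le2[OF conn_bound_le(3) conn_bound_le(3), of a b "[c]"] by auto
  next
    case 8
    then show ?thesis
      using x q' prod_conn_bound_le3[OF conn_bound_le(2) conn_bound_le(2) conn_bound_le(2), of a b c "[]"] by auto
  qed
qed

text \<open>Balance forces \<open>b\<close> to be at least 2, so at most two parts are single
  vertices and \<open>q\<close> is at most 1/8. A product up to 3/4 then yields 1/2. The orders 3,
  2, 2, 2 need the exact value 6/64, because 7/16 + 1/8 exceeds 139/256.\<close>

lemma star_profile_4:
  assumes n: "n \<ge> 9" and s: "a \<ge> b" "b \<ge> c" "c \<ge> d" "Suc (a + b + c + d) = n" "1 \<le> d" "2 * a \<le> n"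
    and x: "x \<le> prod_list (map conn_bound [a, b, c, d])" "x \<le> 7 / 8"
    and q: "q \<le> (6 + real (length (filter (\<lambda>k. k = 1) [a, b, c, d]))) / 64"
  shows "x / 2 + q \<le> 1 / 2 \<or> n = 9 \<and> x / 2 + q < 73 / 128 \<or> n = 10 \<and> x / 2 + q < 139 / 256
    \<or> n = 11 \<and> x / 2 + q < 69 / 128"
proof -
  have b: "2 \<le> b" using n s by linarith
  then have "filter (\<lambda>k. k = 1) [a, b, c, d] = filter (\<lambda>k. k = 1) [c, d]" using s(1) by simp
  then have "real (length (filter (\<lambda>k. k = 1) [a, b, c, d])) \<le> real 2"
    unfolding of_nat_le_iff using length_filter_le[of "\<lambda>k. k = 1" "[c, d]"] by simp
  then have "q \<le> (6 + real 2) / 64" by (intro order_trans[OF q] divide_right_mono add_left_mono) simp_all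
  then have q': "q \<le> 8 / 64" by simp
  consider "n = 9" | "n = 10" "a = 3" "b = 2" "c = 2" "d = 2" | "10 \<le> n" "n \<le> 11" "4 \<le> a"
    | "3 \<le> a" "3 \<le> b" "3 \<le> c" | "10 \<le> n" "n \<le> 11" "3 \<le> a" "3 \<le> b"
    | "5 \<le> a" | "4 \<le> a" "3 \<le> b"
    using n s by linarith
  then show ?thesis
  proof cases
    case 1
    then show ?thesis using x q' by auto
  next
    case 2
    then show ?thesis using x q by auto
  next
    case 3
    then have "n = 10 \<or> n = 11" by auto
    then show ?thesis using x q' prod_conn_bound_le1[OF conn_bound_le(3), of a "[b, c, d]"] 3 by auto
  next
    case 4
    then show ?thesis
      using x q' prod_conn_bound_le3[OF conn_bound_le(2) conn_bound_le(2) conn_bound_le(2), of a b c "[d]"] by auto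
  next
    case 5
    then have "n = 10 \<or> n = 11" by auto
    then show ?thesis
      using x q' prod_conn_bound_le2[OF conn_bound_le(2) conn_bound_le(2), of a b "[c, d]"] 5 by auto
  next
    case 6
    then show ?thesis using x q' prod_conn_bound_le1[OF conn_bound_le(4), of a "[b, c, d]"] by auto
  next
    case 7
    then show ?thesis
      using x q' prod_conn_bound_le2[OF conn_bound_le(3) conn_bound_le(2), of a b "[c, d]"] by auto
  qed
qed


text \<open>Even five single vertices give \<open>q\<close> at most 12/128, which with 7/16 is below
  all three thresholds. From order 12 on a product up to 13/16 suffices; only the orders 3, 2, 2, 2,
  2 miss it, and there the absence of single vertices gives 7/128.\<close>

lemma star_profile_5:
  assumes n: "n \<ge> 9" and s: "a \<ge> b" "b \<ge> c" "c \<ge> d" "d \<ge> e" "Suc (a + b + c + d + e) = n" "1 \<le> e"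
    and x: "x \<le> prod_list (map conn_bound [a, b, c, d, e])" "x \<le> 7 / 8"
    and q: "q \<le> (7 + real (length (filter (\<lambda>k. k = 1) [a, b, c, d, e]))) / 128"
  shows "x / 2 + q \<le> 1 / 2 \<or> n = 9 \<and> x / 2 + q < 73 / 128 \<or> n = 10 \<and> x / 2 + q < 139 / 256
    \<or> n = 11 \<and> x / 2 + q < 69 / 128"
proof -
  have "real (length (filter (\<lambda>k. k = 1) [a, b, c, d, e])) \<le> real 5"
    unfolding of_nat_le_iff using length_filter_le[of "\<lambda>k. k = 1" "[a, b, c, d, e]"] by simp
  then have "q \<le> (7 + real 5) / 128" by (intro order_trans[OF q] divide_right_mono add_left_mono) simp_all
  then have q': "q \<le> 12 / 128" by simp
  consider "n = 9 \<or> n = 10 \<or> n = 11" | "4 \<le> a" | "3 \<le> a" "3 \<le> b" | "a = 3" "b = 2" "c = 2" "d = 2" "e = 2"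
    using n s by linarith
  then show ?thesis
  proof cases
    case 1
    then show ?thesis using x q' by auto
  next
    case 2
    then show ?thesis using x q' prod_conn_bound_le1[OF conn_bound_le(3), of a "[b, c, d, e]"] by auto
  next
    case 3
    then show ?thesis
      using x q' prod_conn_bound_le2[OF conn_bound_le(2) conn_bound_le(2), of a b "[c, d, e]"] by auto
  next
    case 4
    then show ?thesis using x q by auto
  qed
qed

text \<open>Two parts of at most half the order are almost equal. The tail is 33/128 + 15/64 =
  63/128; the smaller orders use their thresholds.\<close>

lemma star_profile_2:
  assumes n: "n \<ge> 9" and s: "a \<ge> b" "Suc (a + b) = n" "2 * a \<le> n"
    and x: "x \<le> prod_list (map conn_bound [a, b])"
    and q: "q \<le> 15 / 64"
  shows "x / 2 + q \<le> 1 / 2 \<or> n = 9 \<and> x / 2 + q < 73 / 128 \<or> n = 10 \<and> x / 2 + q < 139 / 256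
    \<or> n = 11 \<and> x / 2 + q < 69 / 128"
proof -
  consider "n = 9" "4 \<le> a" "4 \<le> b" | "n = 10" "5 \<le> a" "4 \<le> b" | "n = 11" "5 \<le> a" "5 \<le> b"
    | "6 \<le> a" "5 \<le> b"
    using n s by linarith
  then show ?thesis
  proof cases
    case 1
    then show ?thesis using x q prod_conn_bound_le2[OF conn_bound_le(3) conn_bound_le(3), of a b "[]"] by auto
  next
    case 2
    then show ?thesis using x q prod_conn_bound_le2[OF conn_bound_le(4) conn_bound_le(3), of a b "[]"] by auto
  next
    case 3
    then show ?thesis using x q prod_conn_bound_le2[OF conn_bound_le(4) conn_bound_le(4), of a b "[]"] by auto
  next
    case 4
    then show ?thesis using x q prod_conn_bound_le2[OF conn_bound_le(5) conn_bound_le(4), of a b "[]"] by auto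
  qed
qed

text \<open>The worst case is six single vertices: \<open>q\<close> is at most 14/256, and 7/16 +
  7/128 = 63/128. For more parts the denominator doubles while the numerator at most
  doubles.\<close>

lemma star_profile_ge6:
  assumes "6 \<le> D" "x \<le> 7 / 8" "q \<le> (2 + real D + real s) / 2 ^ (D + 2)" "s \<le> D"
  shows "x / 2 + q \<le> 1 / 2"
proof -
  have "128 * (2 + 2 * real D) \<le> 7 * 2 ^ (D + 2)"
    using assms(1)
  proof (induction D rule: nat_induct_at_least)
    case (Suc D)
    have "128 * (2 + 2 * real (Suc D)) \<le> 2 * (128 * (2 + 2 * real D))" by simp
    also have "\<dots> \<le> 7 * 2 ^ (Suc D + 2)" using Suc.IH by simp
    finally show ?case .
  qed simp
  then have "(2 + 2 * real D) / 2 ^ (D + 2) \<le> 7 / 128"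
    by (simp add: field_simps)
  moreover have "(2 + real D + real s) / 2 ^ (D + 2) \<le> (2 + 2 * real D) / 2 ^ (D + 2)"
    using assms(4) by (intro divide_right_mono) auto
  ultimately have "q \<le> 7 / 128" using assms(3) by linarith
  then show ?thesis using assms(2) by linarith
qed

context sgraph
begin

lemma dens_path3:
  assumes "adj v x" "adj v y" "x \<noteq> y"
  shows "dens {v, x, y} \<le> 7 / 8"
proof -
  let ?T = "{v, x, y}"
  have ne: "v \<noteq> x" "v \<noteq> y" using assms adj_irrefl by auto
  have "dsets ?T \<subseteq> Pow ?T - {?T}"
    using assms by (auto simp: dsets_def)
  then have "card (dsets ?T) \<le> card (Pow ?T - {?T})"
    by (intro card_mono) auto
  also have "\<dots> = 7"
    using ne assms(3) by (subst card_Diff_singleton) (auto simp: card_Pow)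
  finally show ?thesis using ne assms(3) by (simp add: dens_def)
qed

lemma dens_no_apex:
  assumes V: "conn V" "finite V" "9 \<le> card V"
    and no_apex: "\<forall>u\<in>V. \<exists>v x y. {v, x, y} \<subseteq> V - {u} \<and> adj v x \<and> adj v y \<and> x \<noteq> y"
  shows "dens V \<le> 1 / 2 \<or> card V = 9 \<and> dens V < 73 / 128
    \<or> card V = 10 \<and> dens V < 139 / 256 \<or> card V = 11 \<and> dens V < 69 / 128"
proof -
  have m: "dens B \<le> conn_bound (card B)" if "B \<subseteq> V" "conn B" for B
  proof -
    have "finite B" using that V(2) finite_subset by blast
    then show ?thesis
      using dens_le_1[of B] dens_conn_3[OF that(2)] dens_conn_4[OF that(2)] dens_conn_5[OF that(2)]
        dens_conn_6[OF that(2)]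
      by (auto simp: conn_bound_def)
  qed
  obtain u P ks where sd: "star_decomp V u P" and mks: "mset ks = image_mset card (mset_set P)"
    and finP: "finite P" and *: "sorted_wrt (\<ge>) ks"
    "Suc (sum_list ks) = card V" "\<And>k. k \<in> set ks \<Longrightarrow> 1 \<le> k \<and> 2 * k \<le> card V"
    "dens (V - {u}) \<le> prod_list (map conn_bound ks)"
    "dens_at V u \<le> (2 + real (length ks) + real (length (filter (\<lambda>k. k = 1) ks))) / 2 ^ (length ks + 2)"
    by (rule star_bound[OF V(1,2), of conn_bound]) (use m in auto)
  have uV: "u \<in> V" using sd unfolding star_decomp_def by blast
  obtain v x y where vxy: "{v, x, y} \<subseteq> V - {u}" "adj v x" "adj v y" "x \<noteq> y"
    using no_apex uV by blast
  have x: "dens (V - {u}) \<le> 7 / 8"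
    using dens_antimono[OF _ vxy(1)] dens_path3[OF vxy(2-4)] V(2) by (meson finite_Diff order_trans)
  have "length ks \<noteq> 0" using *(2) V(3) by auto
  moreover have "length ks \<noteq> 1" using *(2,3) V(3) by (auto simp: length_Suc_conv)
  ultimately consider "length ks = 2" | "length ks = 3" | "length ks = 4" | "length ks = 5" | "6 \<le> length ks"
    by linarith
  then show ?thesis unfolding dens_split[OF V(2) uV]
  proof cases
    case 1
    then obtain a b where ks: "ks = [a, b]" using list_lengths(1) by blast
    have ab: "a \<ge> b" "Suc (a + b) = card V" "2 * a \<le> card V"
      using *(1-3) ks by auto
    have "card P = 2" using arg_cong[OF mks, of size] 1 by simp
    then obtain B C where P: "P = {B, C}" "B \<noteq> C" by (auto simp: card_2_iff)
    \<comment> \<open>Which of \<open>B\<close> and \<open>C\<close> has order \<open>a\<close> is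
      unknown and irrelevant: balance makes both \<open>a\<close> and \<open>b\<close> at least
      4.\<close>
    have "{#a, b#} = {#card B, card C#}" using mks ks P by simp
    then have "card B \<in># {#a, b#}" "card C \<in># {#a, b#}" by simp_all
    then have card: "4 \<le> card B" "2 \<le> card C" using ab V(3) by auto
    have UP: "B \<union> C = V - {u}" and disj: "B \<inter> C = {}"
      and c: "conn B" "conn C" "\<exists>a\<in>B. adj u a" "\<exists>c\<in>C. adj u c"
      using sd P unfolding star_decomp_def by (auto simp: pairwise_insert disjnt_def)
    obtain a' c' where "a' \<in> B" "adj u a'" "c' \<in> C" "adj u c'" using c by blast
    moreover have "finite B" "finite C" using UP V(2) by (metis finite_Diff finite_Un)+
    ultimately have "dens_at V u \<le> 15 / 64"
      using dens_at_two_branches[of B a' u C c' V] c card UP disj uV by blast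
    then show "dens (V - {u}) / 2 + dens_at V u \<le> 1 / 2 \<or> card V = 9 \<and> dens (V - {u}) / 2 + dens_at V u < 73 / 128
      \<or> card V = 10 \<and> dens (V - {u}) / 2 + dens_at V u < 139 / 256
      \<or> card V = 11 \<and> dens (V - {u}) / 2 + dens_at V u < 69 / 128"
      using star_profile_2[OF V(3) ab] *(4) ks by blast
  next
    case 2
    then obtain a b c where ks: "ks = [a, b, c]" using list_lengths(2)[of ks] by blast
    show "dens (V - {u}) / 2 + dens_at V u \<le> 1 / 2 \<or> card V = 9 \<and> dens (V - {u}) / 2 + dens_at V u < 73 / 128
      \<or> card V = 10 \<and> dens (V - {u}) / 2 + dens_at V u < 139 / 256
      \<or> card V = 11 \<and> dens (V - {u}) / 2 + dens_at V u < 69 / 128"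
      using star_profile_3[OF V(3), of b a c "dens (V - {u})" "dens_at V u"] * ks by auto
  next
    case 3
    then obtain a b c d where ks: "ks = [a, b, c, d]" using list_lengths(3)[of ks] by blast
    show "dens (V - {u}) / 2 + dens_at V u \<le> 1 / 2 \<or> card V = 9 \<and> dens (V - {u}) / 2 + dens_at V u < 73 / 128
      \<or> card V = 10 \<and> dens (V - {u}) / 2 + dens_at V u < 139 / 256
      \<or> card V = 11 \<and> dens (V - {u}) / 2 + dens_at V u < 69 / 128"
      using star_profile_4[OF V(3), of b a c d "dens (V - {u})" "dens_at V u"] * x ks by auto
  next
    case 4
    then obtain a b c d e where ks: "ks = [a, b, c, d, e]" using list_lengths(4)[of ks] by blast
    show "dens (V - {u}) / 2 + dens_at V u \<le> 1 / 2 \<or> card V = 9 \<and> dens (V - {u}) / 2 + dens_at V u < 73 / 128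
      \<or> card V = 10 \<and> dens (V - {u}) / 2 + dens_at V u < 139 / 256
      \<or> card V = 11 \<and> dens (V - {u}) / 2 + dens_at V u < 69 / 128"
      using star_profile_5[OF V(3), of b a c d e "dens (V - {u})" "dens_at V u"] * x ks by auto
  next
    case 5
    then show "dens (V - {u}) / 2 + dens_at V u \<le> 1 / 2 \<or> card V = 9 \<and> dens (V - {u}) / 2 + dens_at V u < 73 / 128
      \<or> card V = 10 \<and> dens (V - {u}) / 2 + dens_at V u < 139 / 256
      \<or> card V = 11 \<and> dens (V - {u}) / 2 + dens_at V u < 69 / 128"
      using star_profile_ge6[OF _ x *(5)] length_filter_le by blast
  qed
qed

lemma card_dsets_no_apex:
  assumes V: "conn V" "finite V" "9 \<le> card V"
    and no_apex: "\<forall>u\<in>V. \<exists>v x y. {v, x, y} \<subseteq> V - {u} \<and> adj v x \<and> adj v y \<and> x \<noteq> y"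
  shows "card (dsets V) < h_bound (card V)"
  using dens_no_apex[OF assms]
proof (elim disjE conjE)
  assume "dens V \<le> 1 / 2"
  moreover have "(2::real) ^ card V = 2 * 2 ^ (card V - 1)" using V(3) by (metis not_numeral_le_zero power_eq_if)
  ultimately have "real (card (dsets V)) \<le> 2 ^ (card V - 1)"
    unfolding dens_def by (simp add: field_simps)
  then have "card (dsets V) \<le> 2 ^ (card V - 1)" by simp
  moreover have "2 ^ (card V - 1) < h_bound (card V)" unfolding h_bound_def by simp
  ultimately show ?thesis by linarith
qed (simp_all add: dens_def h_bound_def)

end

section \<open>Graphs with an apex\<close>

context sgraph
begin

text \<open>
  The apex \<open>u\<close> is adjacent to \<open>A \<union> Q\<close>; each \<open>q \<in> Q\<close> has a private neighbour \<open>g q\<close> not adjacent to \<open>u\<close>,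
  and edges inside \<open>A\<close> are left unspecified.
\<close>

definition apex_decomp :: "'a set \<Rightarrow> 'a \<Rightarrow> 'a set \<Rightarrow> 'a set \<Rightarrow> ('a \<Rightarrow> 'a) \<Rightarrow> bool" where
  "apex_decomp V u A Q g \<longleftrightarrow>
     V = insert u (A \<union> Q \<union> g ` Q) \<and> u \<notin> A \<union> Q \<union> g ` Q \<and> A \<inter> Q = {} \<and> (A \<union> Q) \<inter> g ` Q = {}
     \<and> inj_on g Q
     \<and> (\<forall>x\<in>V. adj u x \<longleftrightarrow> x \<in> A \<union> Q)
     \<and> (\<forall>q\<in>Q. \<forall>x\<in>V. adj q x \<longleftrightarrow> x = u \<or> x = g q)
     \<and> (\<forall>q\<in>Q. \<forall>x\<in>V. adj (g q) x \<longleftrightarrow> x = q)"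

lemma apex_decompD:
  assumes "apex_decomp V u A Q g"
  shows "V = insert u (A \<union> Q \<union> g ` Q)" "u \<notin> A" "u \<notin> Q" "u \<notin> g ` Q" "A \<inter> Q = {}"
    "A \<inter> g ` Q = {}" "Q \<inter> g ` Q = {}" "inj_on g Q"
    "\<And>x. x \<in> V \<Longrightarrow> adj u x \<longleftrightarrow> x \<in> A \<union> Q"
    "\<And>q x. q \<in> Q \<Longrightarrow> x \<in> V \<Longrightarrow> adj q x \<longleftrightarrow> x = u \<or> x = g q"
    "\<And>q x. q \<in> Q \<Longrightarrow> x \<in> V \<Longrightarrow> adj (g q) x \<longleftrightarrow> x = q"
proof -
  note 1 = assms[unfolded apex_decomp_def]
  note 2 = conjunct2[OF 1]
  note 3 = conjunct2[OF 2]
  note 4 = conjunct2[OF 3]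
  note 5 = conjunct2[OF 4]
  note 6 = conjunct2[OF 5]
  show "V = insert u (A \<union> Q \<union> g ` Q)" by (rule conjunct1[OF 1])
  show "u \<notin> A" "u \<notin> Q" "u \<notin> g ` Q" "A \<inter> Q = {}" "A \<inter> g ` Q = {}" "Q \<inter> g ` Q = {}" "inj_on g Q"
    using conjunct1[OF 2] conjunct1[OF 3] conjunct1[OF 4] conjunct1[OF 5]
    by (simp_all add: Int_Un_distrib2)
  show "\<And>x. x \<in> V \<Longrightarrow> adj u x \<longleftrightarrow> x \<in> A \<union> Q"
    "\<And>q x. q \<in> Q \<Longrightarrow> x \<in> V \<Longrightarrow> adj q x \<longleftrightarrow> x = u \<or> x = g q"
    "\<And>q x. q \<in> Q \<Longrightarrow> x \<in> V \<Longrightarrow> adj (g q) x \<longleftrightarrow> x = q"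
    using 6 by simp_all
qed

lemma apex_decomp_in:
  assumes "apex_decomp V u A Q g"
  shows "u \<in> V" "A \<subseteq> V" "Q \<subseteq> V" "g ` Q \<subseteq> V"
  using apex_decompD(1)[OF assms] by auto

lemma apex_decomp_cases:
  assumes "apex_decomp V u A Q g" "x \<in> V"
  obtains "x = u" | "x \<in> A" | "x \<in> Q" | q where "q \<in> Q" "x = g q"
  using apex_decompD(1)[OF assms(1)] assms(2) by auto

lemma apex_decomp_adjA:
  assumes "apex_decomp V u A Q g" "a \<in> A" "x \<in> V" "adj a x"
  shows "x = u \<or> x \<in> A"
proof -
  note D = apex_decompD[OF assms(1)]
  have "a \<in> V" using apex_decomp_in(2)[OF assms(1)] assms(2) by blast
  have "x \<notin> Q"
    using D(10)[of x a] adj_sym[OF assms(4)] \<open>a \<in> V\<close> assms(2) D(2,6) by blast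
  moreover have "x \<notin> g ` Q"
    using D(11)[of _ a] adj_sym[OF assms(4)] \<open>a \<in> V\<close> assms(2) D(5) by blast
  ultimately show ?thesis using apex_decomp_cases[OF assms(1,3)] by blast
qed

lemma card_apex_decomp:
  assumes "apex_decomp V u A Q g" "finite V"
  shows "card V = Suc (card A + 2 * card Q)"
proof -
  note D = apex_decompD[OF assms(1)]
  have fin: "finite A" "finite Q"
    using assms(2) finite_subset[OF apex_decomp_in(2)[OF assms(1)]]
      finite_subset[OF apex_decomp_in(3)[OF assms(1)]] by auto
  have "card (A \<union> Q \<union> g ` Q) = card A + card Q + card (g ` Q)"
    using fin D(5-7) by (subst card_Un_disjoint, simp, simp, blast) (simp add: card_Un_disjoint)
  moreover have "card V = Suc (card (A \<union> Q \<union> g ` Q))"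
    using D(1-4) fin by simp
  ultimately show ?thesis using D(8) by (simp add: card_image)
qed

text \<open>Without \<open>u\<close>, each \<open>q\<close> and \<open>g q\<close> form an isolated
  edge, so only paths inside \<open>A\<close> could do harm.\<close>

lemma apex_decomp_dsets:
  assumes "apex_decomp V u A Q g"
    and A: "\<And>v x y. v \<in> A \<Longrightarrow> x \<in> A \<Longrightarrow> y \<in> A \<Longrightarrow> adj v x \<Longrightarrow> adj v y \<Longrightarrow> x = y"
  shows "V - {u} \<in> dsets V"
proof -
  note D = apex_decompD[OF assms(1)]
  have "x = y" if "v \<in> V - {u}" "x \<in> V - {u}" "y \<in> V - {u}" "adj v x" "adj v y" for v x y
  proof -
    have "v \<in> V" "v \<noteq> u" using that(1) by auto
    then consider "v \<in> A" | "v \<in> Q" | q where "q \<in> Q" "v = g q"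
      using apex_decomp_cases[OF assms(1)] by metis
    then show ?thesis
    proof cases
      case 1
      then have "x \<in> A" "y \<in> A"
        using apex_decomp_adjA[OF assms(1) 1, of x] apex_decomp_adjA[OF assms(1) 1, of y] that by auto
      then show ?thesis using A 1 that by blast
    next
      case 2
      then have "x = g v" "y = g v" using D(10)[OF 2, of x] D(10)[OF 2, of y] that by auto
      then show ?thesis by simp
    next
      case 3
      then have "x = q" "y = q" using D(11)[OF 3(1), of x] D(11)[OF 3(1), of y] that by auto
      then show ?thesis by simp
    qed
  qed
  then show ?thesis unfolding dsets_def by blast
qed

text \<open>Without \<open>u\<close> the graph consists of isolated vertices and edges.
  Connectedness lets each of these pieces meet the neighbourhood \<open>N\<close> of
  \<open>u\<close>, so every non-neighbour is the mate of a vertex of \<open>N\<close>; these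
  vertices form \<open>Q\<close>.\<close>

lemma apex_decomp_exists:
  assumes V: "conn V" and u: "u \<in> V" "V - {u} \<in> dsets V"
  obtains A Q g where "apex_decomp V u A Q g"
proof -
  have un: "x = y" if "v \<in> V - {u}" "x \<in> V - {u}" "y \<in> V - {u}" "adj v x" "adj v y" for v x y
    using u(2) that unfolding dsets_def by blast
  define N where "N = {x \<in> V. adj u x}"
  define M where "M = V - {u} - N"
  define Q where "Q = {x \<in> N. \<exists>y\<in>M. adj x y}"
  have "\<forall>q\<in>Q. \<exists>y. y \<in> M \<and> adj q y" unfolding Q_def by blast
  then obtain g where g: "\<And>q. q \<in> Q \<Longrightarrow> g q \<in> M \<and> adj q (g q)"
    using bchoice[of Q "\<lambda>q y. y \<in> M \<and> adj q y"] by blast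
  have mate: "\<exists>q\<in>Q. g q = y" if y: "y \<in> M" for y
  proof -
    have yu: "\<not> adj y u" using y adj_sym unfolding M_def N_def by blast
    have "V \<noteq> {y}" using y u(1) unfolding M_def by blast
    then obtain z where z: "z \<in> V - {y}" "adj y z"
      using conn_has_neighbour[OF V, of y] y unfolding M_def by blast
    have zu: "z \<noteq> u" using z yu by blast
    \<comment> \<open>Otherwise the edge between \<open>y\<close> and \<open>z\<close> would be a
      component of its own, since neither end has another neighbour.\<close>
    have "z \<in> N"
    proof (rule ccontr)
      assume "z \<notin> N"
      then have zu': "\<not> adj z u" using adj_sym z(1) unfolding N_def by blast
      have "{y, z} \<subseteq> V" "{y, z} \<noteq> V" using y z u(1) zu unfolding M_def by blast+
      then obtain a b where ab: "a \<in> {y, z}" "b \<in> V - {y, z}" "adj a b"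
        using conn_cut[OF V, of "{y, z}"] by blast
      have "b \<noteq> u" using ab yu zu' by blast
      then show False
        using ab un[of y z b] un[of z y b] z zu y adj_sym[OF z(2)] unfolding M_def by blast
    qed
    then have zQ: "z \<in> Q" using y adj_sym[OF z(2)] unfolding Q_def by blast
    have "g z = y"
      using un[of z "g z" y] g[OF zQ] adj_sym[OF z(2)] y z zu unfolding M_def by blast
    then show ?thesis using zQ by blast
  qed
  have gQ: "g ` Q = M" using g mate by blast
  have QN: "Q \<subseteq> N" unfolding Q_def by blast
  have NV: "N \<subseteq> V - {u}" unfolding N_def using adj_irrefl by blast
  have MV: "M \<subseteq> V - {u}" "M \<inter> N = {}" unfolding M_def by blast+
  have partner: "x = q" if "q \<in> Q" "x \<in> V" "adj (g q) x" for q x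
  proof -
    have "x \<noteq> u" using that(3) g[OF that(1)] adj_sym unfolding M_def N_def by blast
    then show ?thesis
      using un[of "g q" x q] that g[OF that(1)] adj_sym QN NV MV by blast
  qed
  have "apex_decomp V u (N - Q) Q g"
    unfolding apex_decomp_def gQ
  proof (intro conjI ballI)
    show "V = insert u (N - Q \<union> Q \<union> M)" using QN NV u(1) unfolding M_def by blast
    show "u \<notin> N - Q \<union> Q \<union> M" using QN NV MV by blast
    show "(N - Q \<union> Q) \<inter> M = {}" using QN MV by blast
    show "inj_on g Q"
    proof (rule inj_onI)
      fix p q assume pq: "p \<in> Q" "q \<in> Q" "g p = g q"
      have "adj (g p) q" using g[OF pq(2)] pq(3) adj_sym by simp
      moreover have "q \<in> V" using pq(2) QN NV by blast
      ultimately show "p = q" using partner[OF pq(1), of q] by simp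
    qed
    show "adj u x \<longleftrightarrow> x \<in> N - Q \<union> Q" if "x \<in> V" for x
      using that QN unfolding N_def by blast
    show "adj q x \<longleftrightarrow> x = u \<or> x = g q" if "q \<in> Q" "x \<in> V" for q x
    proof -
      have "q \<in> V - {u}" "adj q u" "adj q (g q)" "g q \<in> V - {u}"
        using that(1) QN NV g[OF that(1)] MV adj_sym unfolding N_def by blast+
      then show ?thesis using un[of q x "g q"] that(2) by blast
    qed
    show "adj (g q) x \<longleftrightarrow> x = q" if "q \<in> Q" "x \<in> V" for q x
      using partner[OF that] g[OF that(1)] adj_sym by blast
  qed auto
  then show thesis using that by blast
qed

text \<open>All subsets avoiding \<open>u\<close> count. With \<open>u\<close>, the set contains at
  most one vertex \<open>z\<close> of \<open>A \<union> Q\<close>, and the private neighbours are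
  free except that \<open>z\<close> in \<open>Q\<close> excludes \<open>g z\<close>. The three later
  summands are no \<open>z\<close>, \<open>z\<close> in \<open>A\<close>, \<open>z\<close> in
  \<open>Q\<close>; for empty \<open>Q\<close> the truncated exponent is multiplied by 0.\<close>

lemma card_dsets_apex:
  assumes D0: "apex_decomp V u A Q g" and fin: "finite V" and "V - {u} \<in> dsets V"
  shows "card (dsets V) = 2 ^ (card V - 1) + 2 ^ card Q + card A * 2 ^ card Q + card Q * 2 ^ (card Q - 1)"
proof -
  note D = apex_decompD[OF D0]
  note I = apex_decomp_in[OF D0]
  have finAQ: "finite A" "finite Q" using fin finite_subset[OF I(2)] finite_subset[OF I(3)] by auto
  have uV: "u \<in> V" by (rule I(1))
  have un: "x = y" if "v \<in> V - {u}" "x \<in> V - {u}" "y \<in> V - {u}" "adj v x" "adj v y" for v x y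
    using assms(3) that unfolding dsets_def by blast
  let ?M = "g ` Q"
  define f where "f z = {y \<in> ?M. \<not> adj z y}" for z
  define E where "E z = (\<lambda>T. insert u (insert z T)) ` Pow (f z)" for z
  have Eiff: "S \<in> E z \<longleftrightarrow> (\<exists>T\<subseteq>f z. S = insert u (insert z T))" for S z
    unfolding E_def by (simp add: image_iff Bex_def)
  have Eform: "u \<in> S \<and> S \<inter> (A \<union> Q) = {z} \<and> S \<subseteq> V" if SE: "S \<in> E z" and z: "z \<in> A \<union> Q" for S z
  proof -
    obtain T where Tf: "T \<subseteq> f z" and S: "S = insert u (insert z T)"
      using iffD1[OF Eiff SE] by auto
    have T: "T \<subseteq> ?M" using Tf unfolding f_def by auto
    have Tsub: "T \<inter> (A \<union> Q) = {}" using T(1) D(6,7) by auto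
    have uA: "u \<notin> A \<union> Q" using D(2,3) by simp
    have "S \<inter> (A \<union> Q) = {z}" using S Tsub uA z by auto
    moreover have "S \<subseteq> V" using S T z I by auto
    ultimately show ?thesis using S by simp
  qed
  have "{S \<in> dsets V. u \<in> S} = insert u ` Pow ?M \<union> (\<Union>z\<in>A \<union> Q. E z)"
  proof (intro equalityI subsetI)
    fix S assume "S \<in> {S \<in> dsets V. u \<in> S}"
    then have SV: "S \<subseteq> V" and uS: "u \<in> S"
      and S: "\<And>v x y. v \<in> S \<Longrightarrow> x \<in> S \<Longrightarrow> y \<in> S \<Longrightarrow> adj v x \<Longrightarrow> adj v y \<Longrightarrow> x = y"
      by (auto simp: dsets_def)
    show "S \<in> insert u ` Pow ?M \<union> (\<Union>z\<in>A \<union> Q. E z)"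
    proof (cases "S \<inter> (A \<union> Q) = {}")
      case True
      have "x \<in> ?M" if "x \<in> S - {u}" for x
      proof -
        have "x \<in> V" "x \<noteq> u" "x \<notin> A" "x \<notin> Q" using that True SV by auto
        then show ?thesis using apex_decomp_cases[OF D0] by (metis imageI)
      qed
      then have "S - {u} \<in> Pow ?M" "S = insert u (S - {u})" using uS by auto
      then show ?thesis by blast
    next
      case False
      then obtain z where z: "z \<in> S" "z \<in> A \<union> Q" by blast
      have uz: "adj u z" using D(9)[of z] z SV by blast
      have yz: "y = z" if "y \<in> S" "y \<in> A \<union> Q" for y
        using S[OF uS that(1) z(1)] D(9)[of y] that uz SV by blast
      have "x \<in> ?M" if "x \<in> S - {u, z}" for x
      proof -
        have "x \<in> V" "x \<noteq> u" "x \<notin> A" "x \<notin> Q" using that yz[of x] SV by auto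
        then show ?thesis using apex_decomp_cases[OF D0] by (metis imageI)
      qed
      then have "S - {u, z} \<subseteq> ?M" by blast
      moreover have "\<not> adj z y" if "y \<in> S - {u, z}" for y
        using S[OF z(1) uS, of y] adj_sym[OF uz] that by blast
      ultimately have "S - {u, z} \<in> Pow (f z)" unfolding f_def by blast
      moreover have "S = insert u (insert z (S - {u, z}))" using uS z by blast
      ultimately have "S \<in> E z" unfolding Eiff by blast
      then show ?thesis using z(2) by blast
    qed
  next
    fix S assume "S \<in> insert u ` Pow ?M \<union> (\<Union>z\<in>A \<union> Q. E z)"
    then have "(\<exists>T\<subseteq>?M. S = insert u T) \<or> (\<exists>z\<in>A \<union> Q. \<exists>T\<subseteq>f z. S = insert u (insert z T))"
      unfolding Un_iff UN_iff Eiff by (simp add: image_iff Bex_def)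
    then consider T where "T \<subseteq> ?M" "S = insert u T"
      | z T where "z \<in> A \<union> Q" "T \<subseteq> f z" "S = insert u (insert z T)"
      by auto
    then show "S \<in> {S \<in> dsets V. u \<in> S}"
    proof cases
      case 1
      have "\<not> adj x y" if "x \<in> S" "y \<in> S" for x y
      proof -
        have "S \<subseteq> V" "S \<inter> (A \<union> Q) = {}" using 1 I D(2,3,6,7) by auto
        then have "x \<in> V" "y \<in> V" "x \<notin> A \<union> Q" "y \<notin> A \<union> Q" using that by auto
        moreover have "x = u \<or> (\<exists>q\<in>Q. x = g q)" using that 1 by auto
        ultimately show ?thesis using D(9)[of y] D(11)[of _ y] by blast
      qed
      moreover have "S \<subseteq> V" using 1 I by blast
      ultimately show ?thesis using 1 unfolding dsets_def by blast
    next
      case 2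
      have T: "T \<subseteq> ?M" "\<And>y. y \<in> T \<Longrightarrow> \<not> adj z y" using 2(2) unfolding f_def by blast+
      have TV: "T \<subseteq> V" "u \<notin> T" "T \<inter> (A \<union> Q) = {}" using T(1) I D(4,6,7) by auto
      have zV: "z \<in> V" "z \<noteq> u" using 2(1) I D(2,3) by auto
      \<comment> \<open>The only neighbour of \<open>g q\<close> is \<open>q\<close>, which could be
        in \<open>S\<close> only as \<open>z\<close>; but \<open>f z\<close> omits the neighbours of
        \<open>z\<close>.\<close>
      have 0: "\<not> adj x y" if "x \<in> S" "y \<in> T" for x y
      proof -
        obtain q where q: "q \<in> Q" "y = g q" using \<open>y \<in> T\<close> T(1) by auto
        have "x \<in> V" using that(1) 2(3) TV zV uV by blast
        then have "adj y x \<longleftrightarrow> x = q" using D(11) q by blast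
        moreover have "x = u \<or> x = z \<or> x \<in> T" using that(1) 2(3) by auto
        ultimately show ?thesis
          using q T(2)[OF that(2)] D(3) TV(3) adj_sym by auto
      qed
      have "x = y" if "v \<in> S" "x \<in> S" "y \<in> S" "adj v x" "adj v y" for v x y
      proof -
        have "v \<notin> T" "x \<notin> T" "y \<notin> T" using 0 adj_sym that by blast+
        then show ?thesis using that 2(3) adj_irrefl by blast
      qed
      then show ?thesis using 2(3) TV zV uV unfolding dsets_def by blast
    qed
  qed
  moreover have "insert u ` Pow ?M \<inter> (\<Union>z\<in>A \<union> Q. E z) = {}"
  proof -
    have "S \<inter> (A \<union> Q) = {}" if "S \<in> insert u ` Pow ?M" for S
      using that D(2-7) by blast
    then show ?thesis using Eform by blast
  qed
  moreover have finE: "finite (E z)" for z unfolding E_def f_def using finAQ by simp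
  ultimately have "card {S \<in> dsets V. u \<in> S} = card (insert u ` Pow ?M) + card (\<Union>z\<in>A \<union> Q. E z)"
    using finAQ by (simp add: card_Un_disjoint)
  moreover have cM: "card ?M = card Q" using D(8) by (simp add: card_image)
  have "card (insert u ` Pow ?M) = 2 ^ card Q"
  proof -
    have "inj_on (insert u) (Pow ?M)"
      by (rule inj_onI) (metis D(4) PowD insert_ident subsetD)
    then show ?thesis using finAQ cM by (simp add: card_image card_Pow)
  qed
  moreover have "card (\<Union>z\<in>A \<union> Q. E z) = (\<Sum>z\<in>A \<union> Q. card (E z))"
  proof (rule card_UN_disjoint)
    show "\<forall>i\<in>A \<union> Q. \<forall>j\<in>A \<union> Q. i \<noteq> j \<longrightarrow> E i \<inter> E j = {}"
      using Eform by (metis (no_types, lifting) disjoint_iff singleton_inject)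
  qed (use finAQ finE in auto)
  moreover have cE: "card (E z) = 2 ^ card (f z)" if "z \<in> A \<union> Q" for z
  proof -
    have "inj_on (\<lambda>T. insert u (insert z T)) (Pow (f z))"
    proof (rule inj_onI)
      fix S T assume ST: "S \<in> Pow (f z)" "T \<in> Pow (f z)" "insert u (insert z S) = insert u (insert z T)"
      have "u \<notin> f z" "z \<notin> f z" using that D(4,6,7) unfolding f_def by auto
      then have "S = insert u (insert z S) - {u, z}" "T = insert u (insert z T) - {u, z}"
        using ST(1,2) by auto
      then show "S = T" using ST(3) by simp
    qed
    moreover have "finite (f z)" unfolding f_def using finAQ by simp
    ultimately show ?thesis unfolding E_def by (simp add: card_image card_Pow)
  qed
  moreover have "(\<Sum>z\<in>A \<union> Q. card (E z)) = card A * 2 ^ card Q + card Q * 2 ^ (card Q - 1)"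
  proof -
    have "(\<Sum>z\<in>A \<union> Q. card (E z)) = (\<Sum>z\<in>A. card (E z)) + (\<Sum>z\<in>Q. card (E z))"
      using finAQ D(5) by (intro sum.union_disjoint) auto
    also have "(\<Sum>z\<in>A. card (E z)) = (\<Sum>z\<in>A. 2 ^ card Q)"
    proof (rule sum.cong[OF refl])
      fix z assume z: "z \<in> A"
      have "f z = ?M"
        unfolding f_def using apex_decomp_adjA[OF D0 z] I D(4,6) by blast
      then show "card (E z) = 2 ^ card Q" using cE z cM by simp
    qed
    also have "(\<Sum>z\<in>Q. card (E z)) = (\<Sum>z\<in>Q. 2 ^ (card Q - 1))"
    proof (rule sum.cong[OF refl])
      fix z assume z: "z \<in> Q"
      have "f z = ?M - {g z}"
        unfolding f_def using D(10)[OF z] I D(4) by blast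
      then show "card (E z) = 2 ^ (card Q - 1)" using cE z cM finAQ by simp
    qed
    finally show ?thesis by simp
  qed
  moreover have "card (dsets (V - {u})) = 2 ^ (card V - 1)"
  proof -
    have "dsets (V - {u}) = Pow (V - {u})"
      using un unfolding dsets_def by blast
    then show ?thesis using fin uV by (simp add: card_Pow)
  qed
  ultimately show ?thesis using card_dsets_split[OF fin, of u] by linarith
qed

end

section \<open>Isomorphisms of decomposed graphs\<close>

lemma card_dsets_iso:
  assumes "sgraph adj" "sgraph adj'" and f: "bij_betw f V V'"
    "\<And>x y. x \<in> V \<Longrightarrow> y \<in> V \<Longrightarrow> adj x y \<longleftrightarrow> adj' (f x) (f y)"
  shows "card (sgraph.dsets adj V) = card (sgraph.dsets adj' V')"
proof -
  interpret G: sgraph adj by fact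
  interpret H: sgraph adj' by fact
  have inj: "inj_on f V" and im: "f ` V = V'" using f(1) unfolding bij_betw_def by auto
  have iff: "f ` S \<in> H.dsets V' \<longleftrightarrow> S \<in> G.dsets V" if "S \<subseteq> V" for S
  proof -
    have *: "f x = f y \<longleftrightarrow> x = y" if "x \<in> S" "y \<in> S" for x y
      using inj that \<open>S \<subseteq> V\<close> by (meson inj_on_eq_iff subsetD)
    have **: "adj x y \<longleftrightarrow> adj' (f x) (f y)" if "x \<in> S" "y \<in> S" for x y
      using f(2) that \<open>S \<subseteq> V\<close> by blast
    have "f ` S \<subseteq> V'" using im that by blast
    then show ?thesis unfolding G.dsets_def H.dsets_def using that by (simp add: * ** cong: ball_cong)
  qed
  have "bij_betw (image f) (G.dsets V) (H.dsets V')"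
  proof (rule bij_betw_imageI)
    show "inj_on (image f) (G.dsets V)"
      using inj_on_image_Pow[OF inj] G.dsets_subset_Pow by (rule inj_on_subset)
    show "(image f) ` G.dsets V = H.dsets V'"
    proof (intro equalityI subsetI)
      fix T assume "T \<in> (image f) ` G.dsets V"
      then show "T \<in> H.dsets V'" using iff G.dsets_subset_Pow by blast
    next
      fix T assume T: "T \<in> H.dsets V'"
      then have "T \<subseteq> f ` V" using H.dsets_subset_Pow im by blast
      then obtain S where "S \<subseteq> V" "T = f ` S" by (meson subset_imageE)
      then show "T \<in> (image f) ` G.dsets V" using iff T by blast
    qed
  qed
  then show ?thesis by (rule bij_betw_same_card)
qed

text \<open>The graph is determined by \<open>card Q\<close> and the graph on \<open>A\<close>: any
  bijection between \<open>Q\<close> and \<open>Q'\<close> extends to the private neighbours, where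
  it is conjugated by \<open>g\<close> and \<open>g'\<close>.\<close>

lemma apex_decomp_iso:
  assumes "sgraph adj" "sgraph adj'"
    and D: "sgraph.apex_decomp adj V u A Q g" "sgraph.apex_decomp adj' V' u' A' Q' g'"
    and fin: "finite V" "finite V'" and card: "card Q = card Q'"
    and \<alpha>: "bij_betw \<alpha> A A'" "\<And>x y. x \<in> A \<Longrightarrow> y \<in> A \<Longrightarrow> adj x y \<longleftrightarrow> adj' (\<alpha> x) (\<alpha> y)"
  shows "\<exists>f. bij_betw f V V' \<and> (\<forall>x\<in>V. \<forall>y\<in>V. adj x y \<longleftrightarrow> adj' (f x) (f y))"
proof -
  interpret G: sgraph adj by fact
  interpret H: sgraph adj' by fact
  note DG = G.apex_decompD[OF D(1)] and DH = H.apex_decompD[OF D(2)]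
  have "finite Q" "finite Q'"
    using fin finite_subset G.apex_decomp_in(3)[OF D(1)] H.apex_decomp_in(3)[OF D(2)] by auto
  then obtain \<beta> where \<beta>: "bij_betw \<beta> Q Q'" using card finite_same_card_bij by blast
  define f where "f x = (if x = u then u' else if x \<in> A then \<alpha> x else if x \<in> Q then \<beta> x
    else g' (\<beta> (the_inv_into Q g x)))" for x
  have fu: "f u = u'" unfolding f_def by simp
  have fA: "f x = \<alpha> x" if "x \<in> A" for x using that DG(2) unfolding f_def by auto
  have fQ: "f x = \<beta> x" if "x \<in> Q" for x using that DG(3,5) unfolding f_def by auto
  have fg: "f (g q) = g' (\<beta> q)" if "q \<in> Q" for q
  proof -
    have "g q \<noteq> u" "g q \<notin> A" "g q \<notin> Q" using that DG(4,6,7) by blast+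
    then show ?thesis using that DG(8) unfolding f_def by (simp add: the_inv_into_f_f)
  qed
  have \<beta>Q: "\<beta> q \<in> Q'" if "q \<in> Q" for q using \<beta> that by (meson bij_betwE)
  have bA: "bij_betw f A A'" using \<alpha>(1) fA by (simp cong: bij_betw_cong)
  have bQ: "bij_betw f Q Q'" using \<beta> fQ by (simp cong: bij_betw_cong)
  have bg: "bij_betw f (g ` Q) (g' ` Q')"
  proof (rule bij_betw_imageI)
    show "inj_on f (g ` Q)"
    proof (rule inj_onI)
      fix x y assume "x \<in> g ` Q" "y \<in> g ` Q" and eq: "f x = f y"
      then obtain p q where pq: "p \<in> Q" "x = g p" "q \<in> Q" "y = g q" by blast
      then have "\<beta> p = \<beta> q" using eq fg \<beta>Q DH(8) by (metis inj_onD)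
      then show "x = y" using pq \<beta> by (metis bij_betw_def inj_onD)
    qed
    have "f ` g ` Q = (\<lambda>q. g' (\<beta> q)) ` Q" using fg by (auto simp: image_image)
    also have "\<dots> = g' ` Q'" using \<beta> unfolding bij_betw_def by (metis image_image)
    finally show "f ` g ` Q = g' ` Q'" .
  qed
  have b0: "bij_betw f {u} {u'}" using fu by (simp add: bij_betw_def)
  have "bij_betw f (A \<union> Q) (A' \<union> Q')" by (rule bij_betw_combine[OF bA bQ DH(5)])
  then have "bij_betw f (A \<union> Q \<union> g ` Q) (A' \<union> Q' \<union> g' ` Q')"
    using bg by (rule bij_betw_combine) (use DH(6,7) in blast)
  then have "bij_betw f ({u} \<union> (A \<union> Q \<union> g ` Q)) ({u'} \<union> (A' \<union> Q' \<union> g' ` Q'))"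
    by (rule bij_betw_combine[OF b0]) (use DH(2-4) in blast)
  then have bij: "bij_betw f V V'" using DG(1) DH(1) by simp
  have inj: "f x = f y \<longleftrightarrow> x = y" if "x \<in> V" "y \<in> V" for x y
    using bij that unfolding bij_betw_def by (meson inj_on_eq_iff)
  have fV: "f x \<in> V'" if "x \<in> V" for x using bij that by (meson bij_betwE)
  note I = G.apex_decomp_in[OF D(1)]
  have VQ: "q \<in> V" "g q \<in> V" if "q \<in> Q" for q using that I by blast+
  have VA: "a \<in> V" if "a \<in> A" for a using that I by blast
  have uV: "u \<in> V" by (rule I(1))
  have iA: "f y \<in> A' \<longleftrightarrow> y \<in> A" if "y \<in> V" for y
  proof -
    have "f ` A = A'" using bA by (simp add: bij_betw_def)
    then show ?thesis using inj[OF that VA] by auto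
  qed
  have iQ: "f y \<in> Q' \<longleftrightarrow> y \<in> Q" if "y \<in> V" for y
  proof -
    have "f ` Q = Q'" using bQ by (simp add: bij_betw_def)
    then show ?thesis using inj[OF that VQ(1)] by auto
  qed
  have "adj x y \<longleftrightarrow> adj' (f x) (f y)" if xy: "x \<in> V" "y \<in> V" for x y
  proof -
    consider "x = u" | "x \<in> A" | "x \<in> Q" | q where "q \<in> Q" "x = g q"
      using G.apex_decomp_cases[OF D(1) xy(1)] by metis
    then show ?thesis
    proof cases
      case 1
      then show ?thesis using DG(9)[OF xy(2)] DH(9)[OF fV[OF xy(2)]] fu iA iQ xy(2) by auto
    next
      case 2
      have fx: "f x \<in> A'" using iA xy 2 by blast
      consider "y = u" | "y \<in> A" | "y \<noteq> u" "y \<notin> A" by blast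
      then show ?thesis
      proof cases
        case 1
        have "adj u x" using DG(9)[OF xy(1)] 2 by blast
        moreover have "adj' u' (f x)" using DH(9)[OF fV[OF xy(1)]] fx by blast
        ultimately show ?thesis using 1 fu G.adj_sym H.adj_sym by blast
      next
        case y: 2
        then show ?thesis using \<alpha>(2) 2 fA by simp
      next
        case 3
        then have "f y \<noteq> u'" "f y \<notin> A'" using inj[OF xy(2) uV] fu iA[OF xy(2)] by auto
        then show ?thesis
          using 3 G.apex_decomp_adjA[OF D(1) 2 xy(2)]
            H.apex_decomp_adjA[OF D(2) fx fV[OF xy(2)]] by blast
      qed
    next
      case 3
      have "adj x y \<longleftrightarrow> y = u \<or> y = g x" using DG(10)[OF 3 xy(2)] .
      also have "\<dots> \<longleftrightarrow> f y = u' \<or> f y = g' (\<beta> x)"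
        using inj[OF xy(2) uV] inj[OF xy(2) VQ(2)[OF 3]] fu fg[OF 3] by auto
      also have "\<dots> \<longleftrightarrow> adj' (f x) (f y)"
        using DH(10)[OF \<beta>Q[OF 3] fV[OF xy(2)]] fQ[OF 3] by simp
      finally show ?thesis .
    next
      case 4
      have "adj x y \<longleftrightarrow> y = q" using DG(11)[OF 4(1) xy(2)] 4(2) by simp
      also have "\<dots> \<longleftrightarrow> f y = \<beta> q" using inj[OF xy(2) VQ(1)[OF 4(1)]] fQ[OF 4(1)] by auto
      also have "\<dots> \<longleftrightarrow> adj' (f x) (f y)"
        using DH(11)[OF \<beta>Q[OF 4(1)] fV[OF xy(2)]] fg[OF 4(1)] 4(2) by simp
      finally show ?thesis .
    qed
  qed
  then show ?thesis using bij by blast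
qed

section \<open>Transfer to digraphs\<close>

lemma sgraph_dominates:
  assumes "graph G"
  shows "sgraph (dominates G)"
proof -
  interpret graph G by fact
  show ?thesis
    by unfold_locales (auto intro: arcs_ends_symmetric[OF sym_arcs] dest: adj_not_same)
qed

lemma num_dissociation_sets_eq_card_dsets:
  assumes "graph G"
  shows "num_dissociation_sets G = card (sgraph.dsets (dominates G) (verts G))"
proof -
  interpret graph G by fact
  interpret S: sgraph "dominates G" by (rule sgraph_dominates) fact
  have "out_degree (G \<restriction> S) v \<le> 1 \<longleftrightarrow>
      (\<forall>x\<in>S. \<forall>y\<in>S. (v, x) \<in> arcs_ends G \<longrightarrow> (v, y) \<in> arcs_ends G \<longrightarrow> x = y)" (is "?L \<longleftrightarrow> ?R")
    if v: "v \<in> S" for S v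
  proof -
    let ?E = "{e \<in> arcs G. tail G e = v \<and> head G e \<in> S}"
    have "out_arcs (G \<restriction> S) v = ?E" using v by (auto simp: out_arcs_def)
    then have "?L \<longleftrightarrow> (\<forall>d\<in>?E. \<forall>e\<in>?E. d = e)"
      by (simp add: out_degree_def card_le_Suc0_iff_eq)
    \<comment> \<open>The out-degree counts arcs, \<open>dsets\<close> compares end vertices; the
      absence of parallel arcs makes this the same.\<close>
    also have "\<dots> \<longleftrightarrow> (\<forall>d\<in>?E. \<forall>e\<in>?E. head G d = head G e)"
      by (auto intro: no_multi_arcs simp: arc_to_ends_def)
    also have "\<dots> \<longleftrightarrow> (\<forall>x\<in>head G ` ?E. \<forall>y\<in>head G ` ?E. x = y)"
      by simp
    also have "head G ` ?E = {x \<in> S. (v, x) \<in> arcs_ends G}"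
      by (auto simp: arcs_ends_conv)
    also have "(\<forall>x\<in>\<dots>. \<forall>y\<in>\<dots>. x = y) \<longleftrightarrow> ?R"
      by simp blast
    finally show ?thesis .
  qed
  then have "{S. dissociation_set G S} = S.dsets (verts G)"
    unfolding dissociation_set_def S.dsets_def by auto
  then show ?thesis unfolding num_dissociation_sets_def by simp
qed

text \<open>Library connectedness refers to the symmetric closure, whose arcs are those of
  \<open>G\<close> here; a walk starting in \<open>X\<close> cannot leave \<open>X\<close> without a
  crossing arc.\<close>

lemma conn_verts:
  assumes "graph G" "Digraph_Component.connected G"
  shows "sgraph.conn (dominates G) (verts G)"
proof -
  interpret graph G by fact
  interpret S: sgraph "dominates G" by (rule sgraph_dominates) fact
  have arcs: "arcs_ends (with_proj (mk_symmetric G)) = arcs_ends G"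
    using sym_arcs unfolding mk_symmetric_def by (auto simp: arcs_ends_conv symmetric_conv)
  have ne: "verts G \<noteq> {}"
    and reach: "\<And>x y. x \<in> verts G \<Longrightarrow> y \<in> verts G \<Longrightarrow> (x, y) \<in> rtrancl_on (verts G) (arcs_ends G)"
    using assms(2) unfolding connected_def strongly_connected_def reachable_def arcs
    by (auto simp: mk_symmetric_def)
  have "\<exists>x\<in>X. \<exists>y\<in>verts G - X. (x, y) \<in> arcs_ends G"
    if X: "X \<subseteq> verts G" "X \<noteq> {}" "X \<noteq> verts G" for X
  proof (rule ccontr)
    assume no: "\<not> ?thesis"
    obtain x y where x: "x \<in> X" and y: "y \<in> verts G" "y \<notin> X" using X by auto
    have "(x, y) \<in> rtrancl_on (verts G) (arcs_ends G)" using reach x y X by blast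
    then have "y \<in> X"
      using x
    proof (induction rule: rtrancl_on_induct)
      case (step y z)
      then show ?case using no by blast
    qed
    then show False using y by blast
  qed
  then show ?thesis using ne unfolding S.conn_def by simp
qed

text \<open>Arcs of \<open>G\<close> have an arbitrary type. Each is sent to the pair of images of
  its ends, which is injective because there are no parallel arcs.\<close>

lemma digraph_iso_pair_graphI:
  assumes "graph G" "pair_graph H" and f: "bij_betw f (verts G) (pverts H)"
    "\<And>x y. x \<in> verts G \<Longrightarrow> y \<in> verts G \<Longrightarrow> (x, y) \<in> arcs_ends G \<longleftrightarrow> (f x, f y) \<in> parcs H"
  shows "digraph_iso G (with_proj H)"
proof -
  interpret graph G by fact
  interpret H: pair_graph H by fact
  define h where "h = \<lparr>iso_verts = f, iso_arcs = (\<lambda>a. (f (tail G a), f (head G a))),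
    iso_head = snd, iso_tail = fst\<rparr>"
  have inj: "inj_on f (verts G)" and im: "f ` verts G = pverts H"
    using f(1) unfolding bij_betw_def by auto
  have "inj_on (iso_arcs h) (arcs G)"
  proof (rule inj_onI)
    fix a b assume ab: "a \<in> arcs G" "b \<in> arcs G" "iso_arcs h a = iso_arcs h b"
    then have "tail G a = tail G b" "head G a = head G b"
      using inj unfolding h_def by (auto dest: inj_onD)
    then show "a = b" using no_multi_arcs ab by (simp add: arc_to_ends_def)
  qed
  then have "digraph_isomorphism h"
    unfolding digraph_isomorphism_def using inj wf_digraph by (auto simp: h_def)
  moreover have "iso_arcs h ` arcs G = parcs H"
  proof (intro equalityI subsetI)
    fix e assume "e \<in> iso_arcs h ` arcs G"
    then obtain a where a: "a \<in> arcs G" "e = (f (tail G a), f (head G a))" unfolding h_def by auto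
    then have "(tail G a, head G a) \<in> arcs_ends G" by (auto simp: arcs_ends_conv)
    then show "e \<in> parcs H" using a f(2) by auto
  next
    fix e assume e: "e \<in> parcs H"
    then obtain x' y' where e': "e = (x', y')" by fastforce
    then have "x' \<in> pverts H" "y' \<in> pverts H" using e H.in_arcsD1 H.in_arcsD2 by blast+
    then obtain x y where xy: "x \<in> verts G" "y \<in> verts G" "x' = f x" "y' = f y" using im by blast
    then have "(x, y) \<in> arcs_ends G" using f(2) e e' by blast
    then obtain a where "a \<in> arcs G" "tail G a = x" "head G a = y" by (auto simp: arcs_ends_conv)
    then show "e \<in> iso_arcs h ` arcs G" using e' xy unfolding h_def by auto
  qed
  then have "with_proj H = app_iso h G"
    unfolding with_proj_def app_iso_def using im by (simp add: h_def)
  ultimately show ?thesis unfolding digraph_iso_def by blast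
qed

lemma digraph_iso_pair_graphD:
  assumes "graph G" "digraph_iso G (with_proj H)"
  obtains f where "bij_betw f (verts G) (pverts H)"
    "\<And>x y. x \<in> verts G \<Longrightarrow> y \<in> verts G \<Longrightarrow> (x, y) \<in> arcs_ends G \<longleftrightarrow> (f x, f y) \<in> parcs H"
proof -
  interpret graph G by fact
  obtain h where h: "digraph_isomorphism h" "with_proj H = app_iso h G"
    using assms(2) unfolding digraph_iso_def by blast
  have eq: "pverts H = iso_verts h ` verts G" "parcs H = iso_arcs h ` arcs G"
    "fst = iso_tail h" "snd = iso_head h"
    using h(2) unfolding with_proj_def app_iso_def by auto
  have inj: "inj_on (iso_verts h) (verts G)"
    and arc: "\<And>a. a \<in> arcs G \<Longrightarrow> iso_arcs h a = (iso_verts h (tail G a), iso_verts h (head G a))"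
    using h(1) unfolding digraph_isomorphism_def eq(3,4)[symmetric] by (auto simp: prod_eq_iff)
  show thesis
  proof (rule that)
    show "bij_betw (iso_verts h) (verts G) (pverts H)" using inj eq(1) by (simp add: bij_betw_def)
    fix x y assume xy: "x \<in> verts G" "y \<in> verts G"
    show "(x, y) \<in> arcs_ends G \<longleftrightarrow> (iso_verts h x, iso_verts h y) \<in> parcs H"
    proof
      assume "(x, y) \<in> arcs_ends G"
      then show "(iso_verts h x, iso_verts h y) \<in> parcs H"
        unfolding eq(2) arcs_ends_conv using arc by force
    next
      assume "(iso_verts h x, iso_verts h y) \<in> parcs H"
      then obtain a where a: "a \<in> arcs G" "(iso_verts h x, iso_verts h y) = iso_arcs h a"
        unfolding eq(2) by blast
      then have "x = tail G a" "y = head G a"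
        using arc[OF a(1)] inj xy by (auto dest: inj_onD)
      then show "(x, y) \<in> arcs_ends G" using a(1) unfolding arcs_ends_conv by blast
    qed
  qed
qed

section \<open>Clique stars as decomposed graphs\<close>

text \<open>
  The graphs \<open>F\<close>, \<open>U\<close> and \<open>T\<close> all have the form \<open>clique_star r (star_comps p b e)\<close>;
  \<open>free_nbs\<close> is then the set \<open>A\<close> of an apex decomposition at the centre \<open>(0, 0)\<close>.
\<close>

definition star_comps :: "nat \<Rightarrow> nat \<Rightarrow> nat \<Rightarrow> nat list" where
  "star_comps p b e = replicate p 1 @ replicate b 2 @ replicate e 1"

definition free_nbs :: "nat \<Rightarrow> nat \<Rightarrow> nat \<Rightarrow> nat \<Rightarrow> (nat \<times> nat) set" where
  "free_nbs r p b e = Pair 0 ` {1..<r} \<union> (\<lambda>i. (i, 0)) ` ({1..p} \<union> {p + b<..p + b + e})"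

lemma nth_star_comps:
  "i \<le> p + b + e \<Longrightarrow>
    (r # star_comps p b e) ! i = (if i = 0 then r else if p < i \<and> i \<le> p + b then 2 else 1)"
  by (cases i) (auto simp: star_comps_def nth_append)

lemma length_star_comps: "length (star_comps p b e) = p + b + e"
  by (simp add: star_comps_def)

lemma pverts_clique_star_iff:
  "(i, j) \<in> pverts (clique_star r (star_comps p b e)) \<longleftrightarrow>
    i \<le> p + b + e \<and> j < (if i = 0 then r else if p < i \<and> i \<le> p + b then 2 else 1)"
  using nth_star_comps[of i p b e r]
  by (auto simp: clique_star_def clique_union_def length_star_comps less_Suc_eq_le)

lemma parcs_clique_star_iff:
  assumes "(i, j) \<in> pverts (clique_star r (star_comps p b e))"
    "(k, l) \<in> pverts (clique_star r (star_comps p b e))"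
  shows "((i, j), (k, l)) \<in> parcs (clique_star r (star_comps p b e)) \<longleftrightarrow>
    (i = k \<and> j \<noteq> l) \<or> (i = 0 \<and> j = 0 \<and> l = 0 \<and> 1 \<le> k) \<or> (k = 0 \<and> l = 0 \<and> j = 0 \<and> 1 \<le> i)"
  using assms by (auto simp: clique_star_def clique_union_def length_star_comps)

lemma pair_graph_star_comps: "1 \<le> r \<Longrightarrow> pair_graph (clique_star r (star_comps p b e))"
  by (rule pair_graph_clique_star) (auto simp: star_comps_def)

lemma graph_star_comps: "1 \<le> r \<Longrightarrow> graph (with_proj (clique_star r (star_comps p b e)))"
proof -
  assume "1 \<le> r"
  then interpret pair_graph "clique_star r (star_comps p b e)" by (rule pair_graph_star_comps)
  show ?thesis by unfold_locales
qed

lemma card_free_nbs: "1 \<le> r \<Longrightarrow> card (free_nbs r p b e) = r - 1 + p + e"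
proof -
  have "card ((\<lambda>i. (i, 0 :: nat)) ` ({1..p} \<union> {p + b<..p + b + e})) = card ({1..p} \<union> {p + b<..p + b + e})"
    by (intro card_image) (auto simp: inj_on_def)
  also have "\<dots> = p + e" by (subst card_Un_disjoint) auto
  finally show ?thesis
    unfolding free_nbs_def by (subst card_Un_disjoint) (auto simp: card_image inj_on_def)
qed

lemma parcs_free_nbs:
  assumes "x \<in> free_nbs r p b e" "y \<in> free_nbs r p b e"
  shows "(x, y) \<in> parcs (clique_star r (star_comps p b e)) \<longleftrightarrow> fst x = 0 \<and> fst y = 0 \<and> x \<noteq> y"
  using assms
  by (cases x; cases y) (auto simp: free_nbs_def parcs_clique_star_iff pverts_clique_star_iff)

text \<open>\<open>Q\<close> consists of the attached vertices \<open>(i, 0)\<close> of the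
  components of order 2, with \<open>(i, 1)\<close> as private neighbours; the rest of the central
  clique and the single vertices form \<open>A\<close>.\<close>

lemma apex_decomp_clique_star:
  assumes "1 \<le> r"
  shows "sgraph.apex_decomp (dominates (with_proj (clique_star r (star_comps p b e))))
    (pverts (clique_star r (star_comps p b e))) (0, 0) (free_nbs r p b e)
    ((\<lambda>i. (i, 0)) ` {p<..p + b}) (\<lambda>x. (fst x, 1))"
proof -
  let ?H = "clique_star r (star_comps p b e)"
  interpret S: sgraph "dominates (with_proj ?H)"
    by (rule sgraph_dominates[OF graph_star_comps[OF assms]])
  have V: "pverts ?H = insert (0, 0) (free_nbs r p b e \<union> (\<lambda>i. (i, 0)) ` {p<..p + b}
      \<union> (\<lambda>x. (fst x, 1)) ` (\<lambda>i. (i, 0 :: nat)) ` {p<..p + b})" (is "_ = ?W")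
  proof (rule set_eqI)
    fix x :: "nat \<times> nat"
    show "x \<in> pverts ?H \<longleftrightarrow> x \<in> ?W"
      using assms
      by (cases x) (auto simp: pverts_clique_star_iff free_nbs_def less_Suc_eq image_iff numeral_2_eq_2 split: if_splits)
  qed
  show ?thesis
    unfolding S.apex_decomp_def unfolding with_proj_simps
  proof (intro conjI ballI)
    show "pverts ?H = ?W" by (rule V)
    fix x assume "x \<in> pverts ?H"
    then obtain k l where x: "x = (k, l)" "(k, l) \<in> pverts ?H" by (cases x) auto
    have 0: "(0, 0) \<in> pverts ?H" using assms by (simp add: pverts_clique_star_iff)
    show "((0, 0), x) \<in> parcs ?H \<longleftrightarrow> x \<in> free_nbs r p b e \<union> (\<lambda>i. (i, 0)) ` {p<..p + b}"
      using x(2) unfolding x(1) parcs_clique_star_iff[OF 0 x(2)]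
      by (auto simp: free_nbs_def pverts_clique_star_iff image_iff split: if_splits)
    fix q assume "q \<in> (\<lambda>i. (i, 0 :: nat)) ` {p<..p + b}"
    then obtain i where q: "q = (i, 0)" "p < i" "i \<le> p + b" by auto
    have q0: "(i, 0) \<in> pverts ?H" and q1: "(i, 1) \<in> pverts ?H"
      using q by (auto simp: pverts_clique_star_iff)
    show "(q, x) \<in> parcs ?H \<longleftrightarrow> x = (0, 0) \<or> x = (fst q, 1)"
      using x(2) q unfolding x(1) q(1) parcs_clique_star_iff[OF q0 x(2)]
      by (auto simp: pverts_clique_star_iff split: if_splits)
    show "((fst q, 1), x) \<in> parcs ?H \<longleftrightarrow> x = q"
      using x(2) q unfolding x(1) q(1) fst_conv parcs_clique_star_iff[OF q1 x(2)]
      by (auto simp: pverts_clique_star_iff split: if_splits)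
  qed (auto simp: free_nbs_def inj_on_def)
qed

section \<open>Comparison of the counts\<close>

text \<open>The number of dissociation sets containing the apex, for \<open>a = card A\<close> and \<open>b = card Q\<close>.\<close>

definition apex_excess :: "nat \<Rightarrow> nat \<Rightarrow> nat" where
  "apex_excess a b = 2 ^ b + a * 2 ^ b + b * 2 ^ (b - 1)"

lemma double_apex_excess: "2 * apex_excess a b = 2 ^ b * (2 + 2 * a + b)"
  by (cases b) (simp_all add: apex_excess_def algebra_simps)

text \<open>Order is preserved when two vertices of \<open>A\<close> are traded for one of
  \<open>Q\<close> with its private neighbour. After doubling, the claim amounts to 0 < 2a +
  b.\<close>

lemma apex_excess_less: "1 \<le> a \<Longrightarrow> apex_excess (a + 2) b < apex_excess a (Suc b)"
proof -
  assume "1 \<le> a"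
  then have "2 ^ b * (2 + 2 * (a + 2) + b) < 2 ^ b * (2 * (2 + 2 * a + Suc b))"
    by (intro mult_strict_left_mono) auto
  then have "2 * apex_excess (a + 2) b < 2 * apex_excess a (Suc b)"
    unfolding double_apex_excess by (simp add: mult.assoc)
  then show ?thesis by simp
qed

lemma apex_excess_less_add: "1 \<le> a \<Longrightarrow> apex_excess (a + 2 * Suc k) b < apex_excess a (b + Suc k)"
proof (induction k arbitrary: b)
  case 0
  then show ?case using apex_excess_less by simp
next
  case (Suc k)
  have "apex_excess (a + 2 * Suc (Suc k)) b = apex_excess ((a + 2 * Suc k) + 2) b" by simp
  also have "\<dots> < apex_excess (a + 2 * Suc k) (Suc b)" using Suc.prems by (intro apex_excess_less) simp
  also have "\<dots> < apex_excess a (Suc b + Suc k)" by (rule Suc.IH[OF Suc.prems])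
  finally show ?case by simp
qed

text \<open>For \<open>c = k + 2\<close> the excess is \<open>2 ^ k * (2 * k + 16)\<close> or
  \<open>2 ^ k * (2 * k + 20)\<close> at order \<open>2 * k + 7\<close> or \<open>2 * k + 8\<close>;
  this is the origin of \<open>n + 9\<close> and \<open>n + 12\<close>.\<close>

lemma h_bound_eq:
  assumes "a = 2 \<or> a = 3" "n = Suc (a + 2 * c)" "9 \<le> n"
  shows "h_bound n = 2 ^ (n - 1) + apex_excess a c"
proof -
  have "2 \<le> c" using assms by auto
  then obtain k where k: "c = k + 2" using le_Suc_ex by (metis add.commute)
  show ?thesis
    using assms(1)
  proof
    assume a: "a = 2"
    then have "n = 2 * k + 7" using assms(2) k by simp
    then show ?thesis using a k by (simp add: h_bound_def apex_excess_def algebra_simps)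
  next
    assume a: "a = 3"
    then have "n = 2 * k + 8" using assms(2) k by simp
    then show ?thesis using a k by (simp add: h_bound_def apex_excess_def algebra_simps)
  qed
qed

text \<open>The order fixes the parity of \<open>a\<close>, so \<open>a\<close> exceeds the smallest
  admissible value \<open>a0\<close> by \<open>2 * k\<close>, and \<open>k\<close> trades lead to
  the maximum.\<close>

lemma apex_excess_le_h_bound:
  assumes "n = Suc (a + 2 * b)" "9 \<le> n" "2 \<le> a"
  shows "2 ^ (n - 1) + apex_excess a b \<le> h_bound n"
    and "2 ^ (n - 1) + apex_excess a b = h_bound n \<longleftrightarrow> a \<le> 3"
proof -
  define a0 k where "a0 = (if even a then 2 else 3 :: nat)" and "k = (a - a0) div 2"
  have a: "a = a0 + 2 * k" "a0 = 2 \<or> a0 = 3"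
    using assms(3) unfolding a0_def k_def by (auto elim!: evenE oddE)
  have h: "h_bound n = 2 ^ (n - 1) + apex_excess a0 (b + k)"
    using a assms(1,2) by (intro h_bound_eq) auto
  have "apex_excess a b < apex_excess a0 (b + k)" if "k \<noteq> 0"
    using apex_excess_less_add[of a0 "k - 1" b] a that by auto
  moreover have "apex_excess a b = apex_excess a0 (b + k)" if "k = 0" using a that by simp
  moreover have "k = 0 \<longleftrightarrow> a \<le> 3" using a by auto
  ultimately show "2 ^ (n - 1) + apex_excess a b \<le> h_bound n"
    and "2 ^ (n - 1) + apex_excess a b = h_bound n \<longleftrightarrow> a \<le> 3"
    unfolding h by (cases "k = 0"; fastforce)+
qed

section \<open>Recognition of the extremal graphs\<close>

lemma digraph_iso_clique_starI:
  assumes G: "graph G" and D: "sgraph.apex_decomp (dominates G) (verts G) u A Q g" and r: "1 \<le> r"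
    and \<alpha>: "bij_betw \<alpha> A (free_nbs r p (card Q) e)"
    "\<And>x y. x \<in> A \<Longrightarrow> y \<in> A \<Longrightarrow>
      (x, y) \<in> arcs_ends G \<longleftrightarrow> fst (\<alpha> x) = 0 \<and> fst (\<alpha> y) = 0 \<and> \<alpha> x \<noteq> \<alpha> y"
  shows "digraph_iso G (with_proj (clique_star r (star_comps p (card Q) e)))"
proof -
  let ?b = "card Q"
  let ?H = "clique_star r (star_comps p ?b e)"
  interpret graph G by fact
  interpret H: pair_graph ?H by (rule pair_graph_star_comps[OF r])
  have "\<exists>f. bij_betw f (verts G) (pverts ?H)
    \<and> (\<forall>x\<in>verts G. \<forall>y\<in>verts G. dominates G x y \<longleftrightarrow> dominates (with_proj ?H) (f x) (f y))"
  proof (rule apex_decomp_iso[OF sgraph_dominates[OF G] sgraph_dominates[OF graph_star_comps[OF r]]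
        D apex_decomp_clique_star[OF r] _ _ _ \<alpha>(1)])
    show "finite (pverts ?H)" by simp
    show "card Q = card ((\<lambda>i. (i, 0 :: nat)) ` {p<..p + ?b})"
      by (subst card_image) (auto simp: inj_on_def)
    show "dominates G x y \<longleftrightarrow> dominates (with_proj ?H) (\<alpha> x) (\<alpha> y)" if "x \<in> A" "y \<in> A" for x y
    proof -
      have "\<alpha> x \<in> free_nbs r p ?b e" "\<alpha> y \<in> free_nbs r p ?b e" using \<alpha>(1) that by (auto dest: bij_betwE)
      then show ?thesis using \<alpha>(2)[OF that] parcs_free_nbs by simp
    qed
  qed simp
  then obtain f where "bij_betw f (verts G) (pverts ?H)"
    "\<And>x y. x \<in> verts G \<Longrightarrow> y \<in> verts G \<Longrightarrow> (x, y) \<in> arcs_ends G \<longleftrightarrow> (f x, f y) \<in> parcs ?H"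
    by auto
  then show ?thesis by (rule digraph_iso_pair_graphI[OF G pair_graph_star_comps[OF r]])
qed

text \<open>For \<open>r \<le> 3\<close> at most two vertices of the central clique remain without
  the centre, so the centre is an apex.\<close>

lemma num_dissociation_sets_clique_star:
  assumes G: "graph G" and r: "1 \<le> r" "r \<le> 3"
    and iso: "digraph_iso G (with_proj (clique_star r (star_comps p b e)))"
  shows "num_dissociation_sets G = 2 ^ (card (verts G) - 1) + apex_excess (r - 1 + p + e) b"
proof -
  let ?H = "clique_star r (star_comps p b e)"
  interpret H: pair_graph ?H by (rule pair_graph_star_comps[OF r(1)])
  interpret S: sgraph "dominates (with_proj ?H)"
    by (rule sgraph_dominates[OF graph_star_comps[OF r(1)]])
  obtain f where f: "bij_betw f (verts G) (pverts ?H)"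
    "\<And>x y. x \<in> verts G \<Longrightarrow> y \<in> verts G \<Longrightarrow> (x, y) \<in> arcs_ends G \<longleftrightarrow> (f x, f y) \<in> parcs ?H"
    using digraph_iso_pair_graphD[OF G iso] by blast
  have "card (sgraph.dsets (dominates G) (verts G)) = card (S.dsets (pverts ?H))"
    by (rule card_dsets_iso[OF sgraph_dominates[OF G] S.sgraph_axioms f(1)]) (use f(2) in simp)
  moreover note D = apex_decomp_clique_star[OF r(1), of p b e]
  have "pverts ?H - {(0, 0)} \<in> S.dsets (pverts ?H)"
  proof (rule S.apex_decomp_dsets[OF D])
    fix v x y assume F: "v \<in> free_nbs r p b e" "x \<in> free_nbs r p b e" "y \<in> free_nbs r p b e"
      and adj: "dominates (with_proj ?H) v x" "dominates (with_proj ?H) v y"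
    have "fst v = 0" "fst x = 0" "fst y = 0" "v \<noteq> x" "v \<noteq> y"
      using adj parcs_free_nbs[OF F(1,2)] parcs_free_nbs[OF F(1,3)] by auto
    moreover have "z = (0, 1) \<or> z = (0, 2)" if z: "z \<in> free_nbs r p b e" "fst z = 0" for z
    proof -
      obtain j where "z = (0, j)" "1 \<le> j" "j < r" using z unfolding free_nbs_def by auto
      then show ?thesis using r(2) by auto
    qed
    ultimately show "x = y" using F by metis
  qed
  then have "card (S.dsets (pverts ?H)) = 2 ^ (card (pverts ?H) - 1)
      + apex_excess (r - 1 + p + e) b"
    using S.card_dsets_apex[OF D] card_free_nbs[OF r(1)]
    by (simp add: card_image inj_on_def apex_excess_def)
  moreover have "card (pverts ?H) = card (verts G)" using f(1) bij_betw_same_card by force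
  ultimately show ?thesis using num_dissociation_sets_eq_card_dsets[OF G] by simp
qed

lemma F_graph_eq:
  assumes "a \<le> 1"
  shows "F_graph (Suc (a + 2 * b)) = clique_star (Suc a) (star_comps 0 b 0)"
proof -
  have "a = 0 \<or> a = 1" using assms by auto
  then show ?thesis unfolding F_graph_def star_comps_def by (auto simp: numeral_2_eq_2[symmetric])
qed

text \<open>The list of \<open>U_graph\<close> has its single vertex last, that of
  \<open>T_graph\<close> has them first; hence the separate parameters \<open>e\<close> and
  \<open>p\<close> of \<open>star_comps\<close>.\<close>

lemma U_graph_eq:
  assumes "a = 2 \<or> a = 3"
  shows "U_graph (Suc (a + 2 * b)) = clique_star 3 (star_comps 0 b (a - 2))"
proof -
  have "(Suc (a + 2 * b) - 3) div 2 = b" using assms by auto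
  moreover have "(Suc (a + 2 * b) + 1) mod 2 = a - 2" using assms by (auto simp: mod_Suc)
  ultimately show ?thesis unfolding U_graph_def star_comps_def by simp
qed

lemma T_graph_eq:
  assumes "a = 2 \<or> a = 3"
  shows "T_graph (Suc (a + 2 * b)) = clique_star 1 (star_comps a b 0)"
proof -
  have "(Suc (2 + 2 * b) - 3) div 2 = b" "(Suc (3 + 2 * b) - 4) div 2 = b" by auto
  then show ?thesis using assms unfolding T_graph_def star_comps_def by auto
qed

lemma num_dissociation_sets_extremal:
  assumes G: "graph G" and n: "card (verts G) = n" "9 \<le> n"
    and iso: "digraph_iso G (with_proj (U_graph n)) \<or> digraph_iso G (with_proj (T_graph n))"
  shows "num_dissociation_sets G = h_bound n"
proof -
  obtain a c where ac: "a = 2 \<or> a = 3" "n = Suc (a + 2 * c)"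
  proof (cases "odd n")
    case True
    then obtain k where "n = 2 * k + 1" by (elim oddE)
    then show ?thesis using that[of 2 "k - 1"] n(2) by auto
  next
    case False
    then obtain k where "n = 2 * k" by blast
    then show ?thesis using that[of 3 "k - 2"] n(2) by auto
  qed
  have "num_dissociation_sets G = 2 ^ (n - 1) + apex_excess a c"
    using iso
  proof
    assume "digraph_iso G (with_proj (U_graph n))"
    then have "num_dissociation_sets G = 2 ^ (n - 1) + apex_excess (3 - 1 + 0 + (a - 2)) c"
      using num_dissociation_sets_clique_star[OF G, of 3 0 c "a - 2"] U_graph_eq[OF ac(1), of c] ac(2) n(1)
      by simp
    moreover have "3 - 1 + 0 + (a - 2) = a" using ac(1) by auto
    ultimately show ?thesis by simp
  next
    assume "digraph_iso G (with_proj (T_graph n))"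
    then show ?thesis
      using num_dissociation_sets_clique_star[OF G, of 1 a c 0] T_graph_eq[OF ac(1), of c] ac(2) n(1)
      by simp
  qed
  then show ?thesis using h_bound_eq[OF ac n(2)] by simp
qed

text \<open>\<open>A\<close> has at most three vertices and induces degrees at most one, hence at
  most one edge. Without an edge all of \<open>A\<close> is pendant at \<open>u\<close>, which is
  \<open>T\<close>; an edge forms a triangle with \<open>u\<close>, which is
  \<open>U\<close>.\<close>

lemma digraph_iso_extremal:
  assumes G: "graph G" and D: "sgraph.apex_decomp (dominates G) (verts G) u A Q g"
    and apex: "verts G - {u} \<in> sgraph.dsets (dominates G) (verts G)"
    and a: "card A = 2 \<or> card A = 3" and n: "card (verts G) = n"
  shows "digraph_iso G (with_proj (U_graph n)) \<or> digraph_iso G (with_proj (T_graph n))"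
proof -
  interpret graph G by fact
  interpret S: sgraph "dominates G" by (rule sgraph_dominates[OF G])
  have n': "n = Suc (card A + 2 * card Q)" using S.card_apex_decomp[OF D] n by simp
  have finA: "finite A" using a card.infinite by fastforce
  have AV: "A \<subseteq> verts G - {u}" using S.apex_decomp_in(2)[OF D] S.apex_decompD(2)[OF D] by blast
  show ?thesis
  proof (cases "\<exists>x\<in>A. \<exists>y\<in>A. (x, y) \<in> arcs_ends G")
    case False
    have "card (free_nbs 1 (card A) (card Q) 0) = card A" by (simp add: card_free_nbs)
    moreover have "finite (free_nbs 1 (card A) (card Q) 0)" unfolding free_nbs_def by simp
    ultimately obtain \<alpha> where \<alpha>: "bij_betw \<alpha> A (free_nbs 1 (card A) (card Q) 0)"
      using finite_same_card_bij[OF finA] by metis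
    have "fst (\<alpha> x) \<noteq> 0" if "x \<in> A" for x
    proof -
      have "\<alpha> x \<in> free_nbs 1 (card A) (card Q) 0" using \<alpha> that by (auto dest: bij_betwE)
      then show ?thesis unfolding free_nbs_def by auto
    qed
    then have "digraph_iso G (with_proj (clique_star 1 (star_comps (card A) (card Q) 0)))"
      using False by (intro digraph_iso_clique_starI[OF G D _ \<alpha>]) auto
    then show ?thesis using T_graph_eq[OF a] n' by simp
  next
    case True
    then obtain x y where xy: "x \<in> A" "y \<in> A" "(x, y) \<in> arcs_ends G" by blast
    have ne: "x \<noteq> y" using xy(3) S.adj_irrefl by blast
    have yx: "(y, x) \<in> arcs_ends G" using xy(3) S.adj_sym by blast
    have un: "z = w" if "v \<in> A" "z \<in> A" "w \<in> A" "(v, z) \<in> arcs_ends G" "(v, w) \<in> arcs_ends G" for v z w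
    proof -
      have "\<forall>v\<in>A. \<forall>z\<in>A. \<forall>w\<in>A. (v, z) \<in> arcs_ends G \<longrightarrow> (v, w) \<in> arcs_ends G \<longrightarrow> z = w"
        using apex AV unfolding S.dsets_def by blast
      then show ?thesis using that by blast
    qed
    let ?C = "(\<lambda>i. (i, 0)) ` {card Q<..card Q + (card A - 2)} :: (nat \<times> nat) set"
    have cC: "card (A - {x, y}) = card A - 2" using xy ne finA by (subst card_Diff_subset) auto
    moreover have "card ?C = card A - 2" by (subst card_image) (auto simp: inj_on_def)
    ultimately obtain \<gamma> where \<gamma>: "bij_betw \<gamma> (A - {x, y}) ?C"
      using finite_same_card_bij[of "A - {x, y}" ?C] finA by auto
    \<comment> \<open>The edge of \<open>A\<close> goes to the non-central vertices of the triangle,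
      the possible third vertex to the single component.\<close>
    define \<alpha> where "\<alpha> z = (if z = x then (0, 1) else if z = y then (0, 2) else \<gamma> z)" for z
    have "bij_betw \<alpha> {x, y} {(0, 1), (0, 2)}"
      using ne by (auto simp: bij_betw_def \<alpha>_def)
    moreover have "bij_betw \<alpha> (A - {x, y}) ?C"
      using \<gamma> by (subst bij_betw_cong[of _ _ \<gamma>]) (auto simp: \<alpha>_def)
    ultimately have "bij_betw \<alpha> ({x, y} \<union> (A - {x, y})) ({(0, 1), (0, 2)} \<union> ?C)"
      by (rule bij_betw_combine) auto
    moreover have "{x, y} \<union> (A - {x, y}) = A" using xy by auto
    moreover have "{(0, 1), (0, 2)} \<union> ?C = free_nbs 3 0 (card Q) (card A - 2)"
    proof -
      have "{1..<3} = {1, 2 :: nat}" by auto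
      then show ?thesis unfolding free_nbs_def by simp
    qed
    ultimately have \<alpha>: "bij_betw \<alpha> A (free_nbs 3 0 (card Q) (card A - 2))" by simp
    have out: "fst (\<alpha> z) \<noteq> 0" if "z \<in> A" "z \<noteq> x" "z \<noteq> y" for z
    proof -
      have "\<alpha> z \<in> ?C" using \<gamma> that unfolding \<alpha>_def by (auto dest: bij_betwE)
      then show ?thesis by auto
    qed
    have sole: "z = w" if "z \<in> A - {x, y}" "w \<in> A - {x, y}" for z w
    proof -
      have "card (A - {x, y}) \<le> Suc 0" using cC a by auto
      then show ?thesis using that finA card_le_Suc0_iff_eq[of "A - {x, y}"] by blast
    qed
    have lone: "(z, w) \<notin> arcs_ends G" if z: "z \<in> A - {x, y}" and w: "w \<in> A" for z w
    proof
      assume zw: "(z, w) \<in> arcs_ends G"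
      then have wz: "(w, z) \<in> arcs_ends G" using S.adj_sym by blast
      consider "w = x" | "w = y" | "w \<in> A - {x, y}" using w by blast
      then show False
      proof cases
        case 1
        then show False using un[of x z y] wz xy z by auto
      next
        case 2
        then show False using un[of y z x] wz xy yx z by auto
      next
        case 3
        then show False using sole[OF z 3] zw S.adj_irrefl by blast
      qed
    qed
    have "digraph_iso G (with_proj (clique_star 3 (star_comps 0 (card Q) (card A - 2))))"
    proof (rule digraph_iso_clique_starI[OF G D _ \<alpha>])
      fix z w assume zw: "z \<in> A" "w \<in> A"
      show "(z, w) \<in> arcs_ends G \<longleftrightarrow> fst (\<alpha> z) = 0 \<and> fst (\<alpha> w) = 0 \<and> \<alpha> z \<noteq> \<alpha> w"
      proof (cases "z \<in> {x, y} \<and> w \<in> {x, y}")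
        case True
        then show ?thesis using xy(3) yx ne S.adj_irrefl by (auto simp: \<alpha>_def)
      next
        case False
        then have "z \<in> A - {x, y} \<or> w \<in> A - {x, y}" using zw by blast
        then show ?thesis using lone[of z w] lone[of w z] out[of z] out[of w] zw S.adj_sym by blast
      qed
    qed simp
    then show ?thesis using U_graph_eq[OF a] n' by simp
  qed
qed

theorem theorem3p3:
  fixes G :: "('a, 'b) pre_digraph" and n :: nat
  assumes "graph G"
    and "Digraph_Component.connected G"
    and "card (verts G) = n"
    and "n \<ge> 9"
    and "\<not> digraph_iso G (with_proj (F_graph n))"
  shows "num_dissociation_sets G \<le> h_bound n \<and>
    (num_dissociation_sets G = h_bound n \<longleftrightarrow>
      digraph_iso G (with_proj (U_graph n)) \<or> digraph_iso G (with_proj (T_graph n)))"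
proof -
  interpret graph G by fact
  interpret S: sgraph "dominates G" by (rule sgraph_dominates) fact
  note G = assms(1)
  have conn: "S.conn (verts G)" using conn_verts assms(1,2) by blast
  note num = num_dissociation_sets_eq_card_dsets[OF G]
  show ?thesis
  proof (cases "\<exists>u\<in>verts G. verts G - {u} \<in> S.dsets (verts G)")
    case False
    have "\<exists>v x y. {v, x, y} \<subseteq> verts G - {u} \<and> dominates G v x \<and> dominates G v y \<and> x \<noteq> y"
      if "u \<in> verts G" for u
    proof -
      have "verts G - {u} \<notin> S.dsets (verts G)" using False that by blast
      then obtain v x y where "v \<in> verts G - {u}" "x \<in> verts G - {u}" "y \<in> verts G - {u}"
        "dominates G v x" "dominates G v y" "x \<noteq> y"
        unfolding S.dsets_def by blast
      then show ?thesis by (intro exI[of _ v] exI[of _ x] exI[of _ y]) simp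
    qed
    then have "card (S.dsets (verts G)) < h_bound n"
      using S.card_dsets_no_apex[OF conn] assms(3,4) by simp
    \<comment> \<open>Since \<open>U\<close> and \<open>T\<close> attain the bound, strictness also
      shows that \<open>G\<close> is neither of them.\<close>
    then show ?thesis
      using num num_dissociation_sets_extremal[OF G assms(3,4)] by auto
  next
    case True
    then obtain u where u: "u \<in> verts G" "verts G - {u} \<in> S.dsets (verts G)" by blast
    obtain A Q g where D: "S.apex_decomp (verts G) u A Q g"
      using S.apex_decomp_exists[OF conn u] by blast
    have n: "n = Suc (card A + 2 * card Q)" using S.card_apex_decomp[OF D] assms(3) by simp
    have count: "num_dissociation_sets G = 2 ^ (n - 1) + apex_excess (card A) (card Q)"
      using S.card_dsets_apex[OF D _ u(2)] num assms(3) by (simp add: apex_excess_def)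
    have finA: "finite A" by (rule finite_subset[OF S.apex_decomp_in(2)[OF D]]) simp
    \<comment> \<open>At most one vertex in \<open>A\<close> would form the central clique of
      \<open>F_graph n\<close> together with \<open>u\<close>.\<close>
    have "2 \<le> card A"
    proof (rule ccontr)
      assume "\<not> 2 \<le> card A"
      then have a: "card A \<le> 1" by simp
      have "card (free_nbs (Suc (card A)) 0 (card Q) 0) = card A" by (simp add: card_free_nbs)
      moreover have "finite (free_nbs (Suc (card A)) 0 (card Q) 0)" unfolding free_nbs_def by simp
      ultimately obtain \<alpha> where \<alpha>: "bij_betw \<alpha> A (free_nbs (Suc (card A)) 0 (card Q) 0)"
        using finite_same_card_bij[OF finA] by metis
      have "x = y" if "x \<in> A" "y \<in> A" for x y
        using a that finA card_le_Suc0_iff_eq by (metis One_nat_def)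
      then have "digraph_iso G (with_proj (clique_star (Suc (card A)) (star_comps 0 (card Q) 0)))"
        using S.adj_irrefl by (intro digraph_iso_clique_starI[OF G D _ \<alpha>]) (simp, metis)
      then show False using assms(5) F_graph_eq[OF a] n by simp
    qed
    note bound = apex_excess_le_h_bound[OF n assms(4) this]
    have "digraph_iso G (with_proj (U_graph n)) \<or> digraph_iso G (with_proj (T_graph n))"
      if "num_dissociation_sets G = h_bound n"
    proof -
      have "card A = 2 \<or> card A = 3" using bound(2) count that \<open>2 \<le> card A\<close> by auto
      then show ?thesis by (rule digraph_iso_extremal[OF G D u(2) _ assms(3)])
    qed
    then show ?thesis
      using bound(1) count num_dissociation_sets_extremal[OF G assms(3,4)] by auto
  qed
qed

end
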